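(* Let $h:[0,\infty)\to[0,\infty)$ be a fixed increasing function with $h(x)\le\sqrt{x}$. For any given decreasing function $\tau:[0,\infty)\to(0,\infty)$ and any infinite sequence of real numbers $0<\mu_1\le\mu_2\le\cdots\to\infty$ satisfying $\sum_{i=1}^\infty\tau(\mu_i)<\infty$, there is a domain $\mathcal D$ of the form $$\mathcal D=\{(x,y)\in\mathbb R^2 : x>0,\ 0<y<f(x)\},$$ where $f:(0,\infty)\to(0,\infty)$ is right-continuous, monotonically decreasing to $0$ on the half-line $[a_1,\infty)$ for some $a_1>0$, and satisfies $\int_0^\infty f(x)\,dx<\infty$ and $$\int_{a_1}^\infty f(x)\,h\big(\pi^2 f(x)^{-2}\big)\,dx<\infty,$$ such that the Dirichlet Laplacian of $\mathcal D$ has an infinite sequence of quasimodes $\psi_{i,m,n}$ ($i,m,n\in\mathbb N$) with quasi-eigenvalues $$\mu_{i,m,n}=n^2\mu_i+m^2\xi_i,\qquad i,m,n\in\mathbb N,$$ where $$\xi_i\asymp\frac{h(\mu_i)^2}{\mu_i\,\tau(\mu_i)^2},$$ so that: (i) $\|(\Delta+\mu_{i,m,n})\psi_{i,m,n}\|=O(m\,\xi_i)\,\|\psi_{i,m,n}\|$; (ii) $\langle\psi_{i,m,n},\psi_{i',m',n'}\rangle=0$ for $i\ne i'$ or $n\ne n'$; (iii) $|\langle\psi_{i,m,n},\psi_{i,m',n}\rangle|\ll\min\{0.001,\,|m-m'|^{-1}\}\,\|\psi_{i,m,n}\|\,\|\psi_{i,m',n}\|$ for $m\ne m'$; (iv)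 for any compact set $\mathcal K\subset\mathcal D$, $$\frac{\|\psi_{i,m,n}\|_{\mathcal D-\mathcal K}}{\|\psi_{i,m,n}\|}\to 1$$ as $i\to\infty$, uniformly for all $m,n\in\mathbb N$.
   Context: Here $\mathbb N=\{1,2,3,\ldots\}$ and $\Delta=\partial_x^2+\partial_y^2$. $\langle\cdot,\cdot\rangle$ and $\|\cdot\|$ denote the inner product and norm of $L^2(\mathcal D)$. For $\mathcal A\subset\mathcal D$, $\|\psi\|_{\mathcal A}=\big(\int_{\mathcal A}|\psi(x,y)|^2\,dx\,dy\big)^{1/2}$. A (nonzero) function $\psi\in H_0^1(\mathcal D)$ is called a quasimode for $-\Delta$ (with Dirichlet boundary conditions) with quasi-eigenvalue $\mu$ and discrepancy $\epsilon$ if $\|(\Delta+\mu)\psi\|\le\epsilon\|\psi\|$ and $\psi|_{\partial\mathcal D}=0$. For two positive quantities $A,B$, $A\ll B$ means that there is a constant $C>0$ with $A\le CB$; $A\asymp B$ means $A\ll B$ and $B\ll A$. The constants implied by $O$, $\ll$ and $\asymp$ do not depend on the indices $i,m,m',n$.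
   Formalization: Two assumptions are added: liminf h(x)/√x = 0 as x→∞ (otherwise, e.g. for h(x)=√x, the integral of f·h(π²f⁻²) diverges for every positive f tending to 0), and h(μ_i)>0 for all i (automatic if h is strictly increasing; needed for ξ_i>0). *)

theory Defs
  imports "HOL-Analysis.Analysis" "HOL-Library.Landau_Symbols"
begin

(* All functions on the plane are real-valued. *)

definition horn_domain :: "(real \<Rightarrow> real) \<Rightarrow> (real \<times> real) set" where
  "horn_domain f = {(x, y). 0 < x \<and> 0 < y \<and> y < f x}"

text \<open>
  Elements of $L^2$ are represented by Borel measurable functions on the whole plane, of which
  only the values on the set in question matter.
\<close>

definition L2_functions :: "(real \<times> real) set \<Rightarrow> (real \<times> real \<Rightarrow> real) set" where
  "L2_functions A = {u. set_borel_measurable lborel A u \<and> set_integrable lborel A (\<lambda>z. (u z)\<^sup>2)}"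

definition L2_inner ::
    "(real \<times> real) set \<Rightarrow> (real \<times> real \<Rightarrow> real) \<Rightarrow> (real \<times> real \<Rightarrow> real) \<Rightarrow> real" where
  "L2_inner A u v = (LINT z:A|lborel. u z * v z)"

definition L2_norm :: "(real \<times> real) set \<Rightarrow> (real \<times> real \<Rightarrow> real) \<Rightarrow> real" where
  "L2_norm A u = sqrt (LINT z:A|lborel. \<bar>u z\<bar>\<^sup>2)"

primrec C_k :: "nat \<Rightarrow> ('a::euclidean_space \<Rightarrow> real) \<Rightarrow> bool" where
  "C_k 0 f \<longleftrightarrow> continuous_on UNIV f"
| "C_k (Suc k) f \<longleftrightarrow>
     (\<forall>x. f differentiable (at x)) \<and> (\<forall>v. C_k k (\<lambda>x. frechet_derivative f (at x) v))"

definition test_functions :: "(real \<times> real) set \<Rightarrow> (real \<times> real \<Rightarrow> real) set" where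
  "test_functions D =
     {\<phi>. (\<forall>k. C_k k \<phi>) \<and> compact (closure {z. \<phi> z \<noteq> 0}) \<and> closure {z. \<phi> z \<noteq> 0} \<subseteq> D}"

definition partial_x :: "(real \<times> real \<Rightarrow> real) \<Rightarrow> real \<times> real \<Rightarrow> real" where
  "partial_x \<phi> z = frechet_derivative \<phi> (at z) (1, 0)"

definition partial_y :: "(real \<times> real \<Rightarrow> real) \<Rightarrow> real \<times> real \<Rightarrow> real" where
  "partial_y \<phi> z = frechet_derivative \<phi> (at z) (0, 1)"

definition laplacian :: "(real \<times> real \<Rightarrow> real) \<Rightarrow> real \<times> real \<Rightarrow> real" where
  "laplacian \<phi> z = partial_x (partial_x \<phi>) z + partial_y (partial_y \<phi>) z"

text \<open>
  \<open>weak_gradient D u g1 g2\<close>: the distributional partial derivatives of \<open>u\<close> on \<open>D\<close>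
  are the functions \<open>g1\<close>, \<open>g2\<close> in $L^2(D)$.
\<close>

definition weak_gradient ::
    "(real \<times> real) set \<Rightarrow> (real \<times> real \<Rightarrow> real) \<Rightarrow> (real \<times> real \<Rightarrow> real)
      \<Rightarrow> (real \<times> real \<Rightarrow> real) \<Rightarrow> bool" where
  "weak_gradient D u g1 g2 \<longleftrightarrow>
     g1 \<in> L2_functions D \<and> g2 \<in> L2_functions D \<and>
     (\<forall>\<phi>\<in>test_functions D.
        L2_inner D u (partial_x \<phi>) = - L2_inner D g1 \<phi> \<and>
        L2_inner D u (partial_y \<phi>) = - L2_inner D g2 \<phi>)"

text \<open>
  $H^1_0(D)$ is the closure of the test functions in $H^1(D)$; membership in it is how the
  Dirichlet condition $u|_{\partial D} = 0$ is expressed.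
\<close>

definition H1_0 :: "(real \<times> real) set \<Rightarrow> (real \<times> real \<Rightarrow> real) set" where
  "H1_0 D = {u \<in> L2_functions D. \<exists>g1 g2. weak_gradient D u g1 g2 \<and>
     (\<exists>\<Phi>. (\<forall>k::nat. \<Phi> k \<in> test_functions D) \<and>
        (\<lambda>k. L2_norm D (\<lambda>z. \<Phi> k z - u z)) \<longlonglongrightarrow> 0 \<and>
        (\<lambda>k. L2_norm D (\<lambda>z. partial_x (\<Phi> k) z - g1 z)) \<longlonglongrightarrow> 0 \<and>
        (\<lambda>k. L2_norm D (\<lambda>z. partial_y (\<Phi> k) z - g2 z)) \<longlonglongrightarrow> 0)}"

definition weak_laplacian ::
    "(real \<times> real) set \<Rightarrow> (real \<times> real \<Rightarrow> real) \<Rightarrow> (real \<times> real \<Rightarrow> real) \<Rightarrow> bool" where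
  "weak_laplacian D u w \<longleftrightarrow>
     w \<in> L2_functions D \<and>
     (\<forall>\<phi>\<in>test_functions D. L2_inner D u (laplacian \<phi>) = L2_inner D w \<phi>)"

definition quasimode ::
    "(real \<times> real) set \<Rightarrow> (real \<times> real \<Rightarrow> real) \<Rightarrow> real \<Rightarrow> real \<Rightarrow> bool" where
  "quasimode D \<psi> \<mu> \<epsilon> \<longleftrightarrow>
     \<psi> \<in> H1_0 D \<and> L2_norm D \<psi> \<noteq> 0 \<and>
     (\<exists>w. weak_laplacian D \<psi> w \<and>
          L2_norm D (\<lambda>z. w z + \<mu> * \<psi> z) \<le> \<epsilon> * L2_norm D \<psi>)"

text \<open>
  If \<open>h\<close> is bounded below by a positive multiple of the square root near infinity, then
  no everywhere positive profile \<open>f\<close> tending to 0 satisfies the weighted area condition: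
  the integrand stays above a positive constant on a half-line.
\<close>

lemma weighted_area_imp_not_bigomega_sqrt:
  fixes f h :: "real \<Rightarrow> real"
  assumes pos: "\<And>x. 0 < x \<Longrightarrow> 0 < f x"
    and lim: "(f \<longlongrightarrow> 0) at_top"
    and int: "set_integrable lborel {a..} (\<lambda>x. f x * h (pi\<^sup>2 / (f x)\<^sup>2))"
    and h_nonneg: "\<And>x. 0 \<le> x \<Longrightarrow> 0 \<le> h x"
  shows "h \<notin> \<Omega>(sqrt)"
proof
  assume "h \<in> \<Omega>(sqrt)"
  then obtain c where c: "c > 0" and ev: "eventually (\<lambda>x. norm (h x) \<ge> c * norm (sqrt x)) at_top"
    by (auto simp: bigomega_def)
  from ev obtain N where N: "\<And>x. x \<ge> N \<Longrightarrow> \<bar>h x\<bar> \<ge> c * \<bar>sqrt x\<bar>"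
    by (auto simp: eventually_at_top_linorder)
  define M where "M = max N 1"
  have "eventually (\<lambda>x. f x < pi / sqrt M) at_top"
    using lim by (rule order_tendstoD) (auto simp: M_def)
  then obtain b0 where b0: "\<And>x. x \<ge> b0 \<Longrightarrow> f x < pi / sqrt M"
    by (auto simp: eventually_at_top_linorder)
  define b where "b = Max {a, b0, 1}"
  have b: "b \<ge> a" "b \<ge> b0" "b \<ge> 1" by (auto simp: b_def)
  have low: "c * pi \<le> f x * h (pi\<^sup>2 / (f x)\<^sup>2)" if x: "x \<ge> b" for x
  proof -
    have fx: "f x > 0" using pos x b by auto
    have "f x * sqrt M < pi" using b0[of x] x b by (auto simp: M_def field_simps)
    hence "sqrt M \<le> pi / f x" using fx by (simp add: field_simps)
    hence "(sqrt M)\<^sup>2 \<le> (pi / f x)\<^sup>2" by (intro power_mono) (auto simp: M_def)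
    hence "N \<le> pi\<^sup>2 / (f x)\<^sup>2" by (auto simp: M_def power_divide)
    from N[OF this] have "c * sqrt (pi\<^sup>2 / (f x)\<^sup>2) \<le> h (pi\<^sup>2 / (f x)\<^sup>2)"
      using h_nonneg[of "pi\<^sup>2 / (f x)\<^sup>2"] by simp
    hence "c * (pi / f x) \<le> h (pi\<^sup>2 / (f x)\<^sup>2)"
      using fx by (simp add: real_sqrt_divide)
    hence "f x * (c * (pi / f x)) \<le> f x * h (pi\<^sup>2 / (f x)\<^sup>2)"
      using fx by (intro mult_left_mono) auto
    thus ?thesis using fx by simp
  qed
  have "set_integrable lborel {b..} (\<lambda>x. f x * h (pi\<^sup>2 / (f x)\<^sup>2))"
    using int by (rule set_integrable_subset) (use b in auto)
  hence "set_integrable lborel {b..} (\<lambda>x. c * pi)"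
    by (rule set_integrable_bound)
       (use low c in \<open>auto simp: set_borel_measurable_def intro!: AE_I2 order_trans[OF low abs_ge_self]\<close>)
  hence "integrable lborel (indicat_real {b..})"
    using c by (simp add: set_integrable_def)
  hence fin: "emeasure lborel {b..} < \<infinity>"
    by (simp add: integrable_indicator_iff)
  have "ennreal (real n) \<le> emeasure lborel {b..}" for n
    using emeasure_mono[of "{b..b + real n}" "{b..}" lborel] by simp
  moreover obtain n where "emeasure lborel {b..} < of_nat n"
    using fin ennreal_Ex_less_of_nat[of "emeasure lborel {b..}"] by auto
  ultimately show False
    by (metis ennreal_of_nat_eq_real_of_nat not_less)
qed

end

theory Submission
  imports Defs "HOL-Real_Asymp.Real_Asymp"
begin

text \<open>
  The profile \<open>f\<close> is a staircase. The \<open>i\<close>-th strip has height \<open>c = \<pi> / sqrt (\<mu> i)\<close> and length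
  \<open>l = sqrt (\<mu> i) * \<tau> (\<mu> i) / h (\<mu> i)\<close>, so that its contribution to the weighted area is exactly
  \<open>\<pi> * \<tau> (\<mu> i)\<close>. The total length of these strips may be finite; since \<open>h (x) / sqrt x\<close> has
  lower limit 0, further strips of unit length can be inserted at infinitely many places at a
  summable cost in weighted area. On the strip starting at \<open>x = a\<close>, with \<open>t = \<pi> (x - a) / l\<close>, the
  quasimode is \<open>sin t * sin (m t) * sin (n \<pi> y / c)\<close>, extended by 0. It vanishes to second order at
  the two ends, so its distributional Laplacian is a function, and with \<open>\<xi> = (\<pi> / l)\<^sup>2\<close> the error is
  \<open>\<xi> (2 m cos t cos (m t) - sin t sin (m t)) sin (n \<pi> y / c)\<close>. Expanding products of sines into
  cosines shows that modes with the same \<open>i\<close> and \<open>n\<close> are orthogonal unless \<open>m\<close> and \<open>m'\<close> differ by 2.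
\<close>

subsection \<open>Smooth functions\<close>

definition smooth :: "('a::euclidean_space \<Rightarrow> real) \<Rightarrow> bool" where
  "smooth f \<longleftrightarrow> (\<forall>k. C_k k f)"

lemma smooth_differentiable: "smooth f \<Longrightarrow> f differentiable (at z)"
  unfolding smooth_def by (metis C_k.simps(2))

lemma smooth_has_derivative:
  "smooth f \<Longrightarrow> (f has_derivative frechet_derivative f (at z)) (at z)"
  using smooth_differentiable frechet_derivative_works by blast

lemma smooth_frechet_derivative: "smooth f \<Longrightarrow> smooth (\<lambda>z. frechet_derivative f (at z) v)"
  unfolding smooth_def by (metis C_k.simps(2))

lemma smooth_continuous_on: "smooth f \<Longrightarrow> continuous_on A f"
  by (meson continuous_at_imp_continuous_on differentiable_imp_continuous_within smooth_differentiable)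

text \<open>By induction on the order, with the function generalised, closure of \<open>P\<close>
  under directional derivatives carries regularity from one order to the next. This spares any
  formula for higher derivatives.\<close>

lemma smooth_coinduct:
  assumes "P f"
    and step: "\<And>f. P f \<Longrightarrow> (\<forall>z. f differentiable (at z)) \<and> (\<forall>v. P (\<lambda>z. frechet_derivative f (at z) v))"
  shows "smooth f"
proof -
  have "P f \<Longrightarrow> C_k k f" for k f
  proof (induction k arbitrary: f)
    case 0
    then show ?case
      using step differentiable_imp_continuous_within continuous_at_imp_continuous_on
      by (metis C_k.simps(1))
  next
    case (Suc k)
    then show ?case using step by simp
  qed
  with \<open>P f\<close> show ?thesis by (simp add: smooth_def)
qed

lemma smooth_partial_x: "smooth f \<Longrightarrow> smooth (partial_x f)"
  and smooth_partial_y: "smooth f \<Longrightarrow> smooth (partial_y f)"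
  unfolding partial_x_def[abs_def] partial_y_def[abs_def] by (auto intro: smooth_frechet_derivative)

text \<open>The bridge from Frechet derivatives on the plane to one-variable calculus: the
  fundamental theorem and the usual derivative rules become usable along horizontal lines.\<close>

lemma partial_x_has_derivative:
  assumes "smooth f"
  shows "((\<lambda>t. f (t, y)) has_real_derivative partial_x f (x, y)) (at x)"
proof -
  have "((\<lambda>t. f (t, y)) has_derivative (\<lambda>h. frechet_derivative f (at (x, y)) (h, 0))) (at x)"
    by (rule has_derivative_compose[OF _ smooth_has_derivative[OF assms]])
       (auto intro!: derivative_eq_intros)
  moreover have "linear (frechet_derivative f (at (x, y)))"
    using smooth_has_derivative[OF assms] has_derivative_linear by blast
  then have "frechet_derivative f (at (x, y)) (h *\<^sub>R (1, 0)) = h *\<^sub>R partial_x f (x, y)" for h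
    unfolding partial_x_def by (rule linear_cmul)
  then have "frechet_derivative f (at (x, y)) (h, 0) = partial_x f (x, y) * h" for h
    by simp
  ultimately show ?thesis by (simp add: has_field_derivative_def)
qed

lemma partial_y_has_derivative:
  assumes "smooth f"
  shows "((\<lambda>t. f (x, t)) has_real_derivative partial_y f (x, y)) (at y)"
proof -
  have "((\<lambda>t. f (x, t)) has_derivative (\<lambda>h. frechet_derivative f (at (x, y)) (0, h))) (at y)"
    by (rule has_derivative_compose[OF _ smooth_has_derivative[OF assms]])
       (auto intro!: derivative_eq_intros)
  moreover have "linear (frechet_derivative f (at (x, y)))"
    using smooth_has_derivative[OF assms] has_derivative_linear by blast
  then have "frechet_derivative f (at (x, y)) (h *\<^sub>R (0, 1)) = h *\<^sub>R partial_y f (x, y)" for h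
    unfolding partial_y_def by (rule linear_cmul)
  then have "frechet_derivative f (at (x, y)) (0, h) = partial_y f (x, y) * h" for h
    by simp
  ultimately show ?thesis by (simp add: has_field_derivative_def)
qed

section \<open>Flat functions built from exp(-1/s)\<close>

text \<open>\<open>flat 1\<close> is the classical smooth function that is not analytic at 0. The
  polynomial factor in \<open>1 / s\<close> is there because differentiation produces such
  factors.\<close>

definition flat :: "real poly \<Rightarrow> real \<Rightarrow> real" where
  "flat p s = (if s > 0 then poly p (1 / s) * exp (- 1 / s) else 0)"

lemma poly_times_exp_minus_tendsto_0: "((\<lambda>r::real. poly p r * exp (- r)) \<longlongrightarrow> 0) at_top"
proof -
  have "((\<lambda>r. \<Sum>i\<le>degree p. coeff p i * (r ^ i / exp r)) \<longlongrightarrow> (\<Sum>i\<le>degree p. coeff p i * 0)) at_top"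
    by (intro tendsto_intros tendsto_power_div_exp_0)
  moreover have "(\<Sum>i\<le>degree p. coeff p i * (r ^ i / exp r)) = poly p r * exp (- r)" for r :: real
    by (simp add: poly_altdef sum_distrib_right exp_minus divide_inverse mult.assoc)
  ultimately show ?thesis by simp
qed

text \<open>With \<open>r = 1 / s\<close> the quotient becomes
  \<open>poly (pCons 0 p) r * exp (- r)\<close>, where \<open>pCons 0 p\<close> absorbs the division
  by \<open>s\<close>. The limit is the derivative of \<open>flat p\<close> at 0.\<close>

lemma flat_over_tendsto_0: "((\<lambda>s. flat p s / s) \<longlongrightarrow> 0) (at 0)"
proof (rule filterlim_split_at)
  have "eventually (\<lambda>s::real. s < 0) (at_left 0)" by (simp add: eventually_at_left_field) (use lt_ex in blast)
  then show "((\<lambda>s. flat p s / s) \<longlongrightarrow> 0) (at_left 0)"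
    by (rule tendsto_eventually[OF eventually_mono]) (simp add: flat_def)
  have "((\<lambda>s::real. poly (pCons 0 p) (inverse s) * exp (- inverse s)) \<longlongrightarrow> 0) (at_right 0)"
    by (rule filterlim_compose[OF poly_times_exp_minus_tendsto_0 filterlim_inverse_at_top_right])
  moreover have "eventually (\<lambda>s::real. s > 0) (at_right 0)" by (simp add: eventually_at_right_less)
  then have "eventually (\<lambda>s::real. poly (pCons 0 p) (inverse s) * exp (- inverse s) = flat p s / s) (at_right 0)"
    by (rule eventually_mono) (simp add: flat_def field_simps)
  ultimately show "((\<lambda>s. flat p s / s) \<longlongrightarrow> 0) (at_right 0)"
    by (rule Lim_transform_eventually)
qed

text \<open>In terms of \<open>r = 1 / s\<close>, whose derivative is \<open>- r\<^sup>2\<close>,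
  the product \<open>p(r) exp(-r)\<close> differentiates to
  \<open>r\<^sup>2 (p - p')(r) exp(-r)\<close>. So the family \<open>flat\<close> is closed under
  differentiation, at 0 as well.\<close>

lemma flat_has_derivative:
  "(flat p has_real_derivative flat ([:0, 0, 1:] * (p - pderiv p)) s) (at s)"
proof (cases s "0::real" rule: linorder_cases)
  case less
  have "((\<lambda>_. 0) has_real_derivative 0) (at s)" by simp
  then have "(flat p has_real_derivative 0) (at s)"
    by (rule has_field_derivative_transform_within_open[of _ _ _ "{..<0}"])
       (use less in \<open>auto simp: flat_def\<close>)
  with less show ?thesis by (simp add: flat_def)
next
  case equal
  then show ?thesis
    using flat_over_tendsto_0[of p] by (simp add: has_field_derivative_iff flat_def)
next
  case greater
  have "((\<lambda>s. - 1 / s) has_real_derivative (1 / s)\<^sup>2) (at s)"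
    using greater by (auto intro!: derivative_eq_intros simp: power2_eq_square)
  from DERIV_fun_exp[OF this]
  have "((\<lambda>s. exp (- 1 / s)) has_real_derivative exp (- 1 / s) * (1 / s)\<^sup>2) (at s)" .
  moreover have "((\<lambda>s. 1 / s) has_real_derivative - ((1 / s)\<^sup>2)) (at s)"
    using greater by (auto intro!: derivative_eq_intros simp: power2_eq_square)
  from DERIV_chain2[OF poly_DERIV this]
  have "((\<lambda>s. poly p (1 / s)) has_real_derivative poly (pderiv p) (1 / s) * - ((1 / s)\<^sup>2)) (at s)" .
  ultimately have "((\<lambda>s. poly p (1 / s) * exp (- 1 / s)) has_real_derivative
      poly (pderiv p) (1 / s) * - ((1 / s)\<^sup>2) * exp (- 1 / s) +
      exp (- 1 / s) * (1 / s)\<^sup>2 * poly p (1 / s)) (at s)"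
    by (rule DERIV_mult[rotated])
  also have "poly (pderiv p) (1 / s) * - ((1 / s)\<^sup>2) * exp (- 1 / s) +
      exp (- 1 / s) * (1 / s)\<^sup>2 * poly p (1 / s) = flat ([:0, 0, 1:] * (p - pderiv p)) s"
    using greater unfolding flat_def
    by (simp only: if_True poly_mult poly_diff) (simp add: power2_eq_square left_diff_distrib right_diff_distrib)
  finally have "((\<lambda>s. poly p (1 / s) * exp (- 1 / s)) has_real_derivative
      flat ([:0, 0, 1:] * (p - pderiv p)) s) (at s)" .
  then show ?thesis
    by (rule has_field_derivative_transform_within_open[of _ _ _ "{0<..}"])
       (use greater in \<open>auto simp: flat_def\<close>)
qed

text \<open>A class of functions closed under directional derivatives, so that membership implies
  smoothness by coinduction.\<close>

inductive trig_flat :: "('a::euclidean_space \<Rightarrow> real) \<Rightarrow> bool" where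
  const: "trig_flat (\<lambda>z. k)"
| sin: "trig_flat (\<lambda>z. sin (v \<bullet> z + q))"
| add: "trig_flat F \<Longrightarrow> trig_flat G \<Longrightarrow> trig_flat (\<lambda>z. F z + G z)"
| mult: "trig_flat F \<Longrightarrow> trig_flat G \<Longrightarrow> trig_flat (\<lambda>z. F z * G z)"
| flat: "trig_flat F \<Longrightarrow> trig_flat (\<lambda>z. flat p (F z))"

lemma trig_flat_derivative:
  assumes "trig_flat F"
  shows "\<exists>F'. (\<forall>z. (F has_derivative F' z) (at z)) \<and> (\<forall>v. trig_flat (\<lambda>z. F' z v))"
  using assms
proof induction
  case (const k)
  show ?case by (rule exI[of _ "\<lambda>_ _. 0"]) (auto intro: trig_flat.const)
next
  case (sin w q)
  \<comment> \<open>Cosine is not a constructor; it is obtained as a sine whose phase is shifted by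
    \<open>pi / 2\<close>.\<close>
  have "trig_flat (\<lambda>z. sin (w \<bullet> z + (q + pi / 2)) * (w \<bullet> v))" for v
    by (intro trig_flat.intros)
  moreover have "sin (w \<bullet> z + (q + pi / 2)) = cos (w \<bullet> z + q)" for z
    using sin_add[of "w \<bullet> z + q" "pi / 2"] by (simp add: add.assoc)
  ultimately have "trig_flat (\<lambda>z. cos (w \<bullet> z + q) * (w \<bullet> v))" for v
    by simp
  moreover have "((\<lambda>z. sin (w \<bullet> z + q)) has_derivative (\<lambda>v. cos (w \<bullet> z + q) * (w \<bullet> v))) (at z)" for z
    by (rule derivative_eq_intros refl)+ (auto simp: mult.commute)
  ultimately show ?case
    by (intro exI[of _ "\<lambda>z v. cos (w \<bullet> z + q) * (w \<bullet> v)"]) blast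
next
  case (add F G)
  then obtain F' G' where "\<And>z. (F has_derivative F' z) (at z)" "\<And>v. trig_flat (\<lambda>z. F' z v)"
    "\<And>z. (G has_derivative G' z) (at z)" "\<And>v. trig_flat (\<lambda>z. G' z v)" by blast
  then show ?case
    by (intro exI[of _ "\<lambda>z v. F' z v + G' z v"]) (auto intro!: has_derivative_add trig_flat.add)
next
  case (mult F G)
  then obtain F' G' where "\<And>z. (F has_derivative F' z) (at z)" "\<And>v. trig_flat (\<lambda>z. F' z v)"
    "\<And>z. (G has_derivative G' z) (at z)" "\<And>v. trig_flat (\<lambda>z. G' z v)" by blast
  with mult show ?case
    by (intro exI[of _ "\<lambda>z v. F z * G' z v + F' z v * G z"])
       (auto intro!: has_derivative_mult trig_flat.add trig_flat.mult)
next
  case (flat F p)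
  then obtain F' where F': "\<And>z. (F has_derivative F' z) (at z)" "\<And>v. trig_flat (\<lambda>z. F' z v)" by blast
  show ?case
  proof (intro exI[of _ "\<lambda>z v. flat ([:0, 0, 1:] * (p - pderiv p)) (F z) * F' z v"] conjI allI)
    show "((\<lambda>z. flat p (F z)) has_derivative
        (\<lambda>v. flat ([:0, 0, 1:] * (p - pderiv p)) (F z) * F' z v)) (at z)" for z
      by (rule has_derivative_compose[OF F'(1)])
         (use flat_has_derivative in \<open>auto simp: has_field_derivative_def\<close>)
    show "trig_flat (\<lambda>z. flat ([:0, 0, 1:] * (p - pderiv p)) (F z) * F' z v)" for v
      using F' flat by (intro trig_flat.intros)
  qed
qed

lemma smooth_trig_flat: "trig_flat F \<Longrightarrow> smooth F"
proof (rule smooth_coinduct[of trig_flat])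
  fix F :: "'a \<Rightarrow> real" assume "trig_flat F"
  then obtain F' where F': "\<And>z. (F has_derivative F' z) (at z)" "\<And>v. trig_flat (\<lambda>z. F' z v)"
    using trig_flat_derivative by blast
  then have "frechet_derivative F (at z) = F' z" for z
    using frechet_derivative_at by metis
  with F' show "(\<forall>z. F differentiable (at z)) \<and> (\<forall>v. trig_flat (\<lambda>z. frechet_derivative F (at z) v))"
    by (auto simp: differentiable_def)
qed

section \<open>Cutting smooth functions off by the indicator of a region\<close>

lemma has_derivative_0_on_open:
  fixes F :: "'a::real_normed_vector \<Rightarrow> real"
  assumes "open U" "z \<in> U" "\<And>z. z \<in> U \<Longrightarrow> F z = 0"
  shows "(F has_derivative (\<lambda>_. 0)) (at z)"
  by (rule has_derivative_transform_within_open[OF has_derivative_const[of 0] assms(1,2)])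
     (use assms(3) in auto)

text \<open>On \<open>U\<close> both \<open>F\<close> and the product vanish identically, so the
  jump of the indicator at the frontier does no harm. Every other point is interior to
  \<open>R\<close> or to its complement, where the indicator is locally constant.\<close>

lemma indicator_times_has_derivative:
  assumes "smooth F" "open U" "frontier R \<subseteq> U" "\<And>z. z \<in> U \<Longrightarrow> F z = 0"
  shows "((\<lambda>z. indicator R z * F z) has_derivative
      (\<lambda>v. indicator R z * frechet_derivative F (at z) v)) (at z)"
proof -
  consider "z \<in> U" | "z \<in> interior R" | "z \<in> interior (- R)"
    using assms(3) by (auto simp: frontier_def interior_complement)
  then show ?thesis
  proof cases
    case 1
    have "frechet_derivative F (at z) = (\<lambda>_. 0)"
      by (rule frechet_derivative_at[symmetric]) (rule has_derivative_0_on_open[OF assms(2) 1 assms(4)])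
    moreover have "((\<lambda>z. indicator R z * F z) has_derivative (\<lambda>_. 0)) (at z)"
      by (rule has_derivative_0_on_open[OF assms(2) 1]) (simp add: assms(4))
    ultimately show ?thesis by simp
  next
    case 2
    have in_R: "w \<in> R" if "w \<in> interior R" for w
      using that interior_subset by blast
    have "((\<lambda>z. indicator R z * F z) has_derivative frechet_derivative F (at z)) (at z)"
      by (rule has_derivative_transform_within_open[OF smooth_has_derivative[OF assms(1)] open_interior 2])
         (simp add: in_R)
    with in_R[OF 2] show ?thesis by simp
  next
    case 3
    have notin_R: "w \<notin> R" if "w \<in> interior (- R)" for w
      using that interior_subset by blast
    have "((\<lambda>z. indicator R z * F z) has_derivative (\<lambda>_. 0)) (at z)"
      by (rule has_derivative_0_on_open[OF open_interior 3]) (simp add: notin_R)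
    with notin_R[OF 3] show ?thesis by simp
  qed
qed

lemma smooth_indicator_times:
  assumes "smooth F" "open U" "frontier R \<subseteq> U" "\<And>z. z \<in> U \<Longrightarrow> F z = 0"
  shows "smooth (\<lambda>z. indicator R z * F z)"
\<comment> \<open>The invariant records the vanishing on \<open>U\<close>. Derivatives inherit it
  because \<open>U\<close> is open, so the formula for the derivative of the product applies
  again.\<close>
proof (rule smooth_coinduct[of "\<lambda>g. \<exists>F. g = (\<lambda>z. indicator R z * F z) \<and> smooth F \<and> (\<forall>z\<in>U. F z = 0)"])
  fix g :: "'a \<Rightarrow> real"
  assume "\<exists>F. g = (\<lambda>z. indicator R z * F z) \<and> smooth F \<and> (\<forall>z\<in>U. F z = 0)"
  then obtain F where F: "g = (\<lambda>z. indicator R z * F z)" "smooth F" "\<And>z. z \<in> U \<Longrightarrow> F z = 0" by blast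
  note der = indicator_times_has_derivative[OF F(2) assms(2,3) F(3)]
  have "frechet_derivative F (at z) = (\<lambda>_. 0)" if "z \<in> U" for z
    by (rule frechet_derivative_at[symmetric]) (rule has_derivative_0_on_open[OF assms(2) that F(3)])
  moreover have "(\<lambda>z. frechet_derivative g (at z) v) = (\<lambda>z. indicator R z * frechet_derivative F (at z) v)" for v
    unfolding F(1) by (simp add: frechet_derivative_at[OF der, symmetric])
  ultimately have "\<exists>F. (\<lambda>z. frechet_derivative g (at z) v) =
      (\<lambda>z. indicator R z * F z) \<and> smooth F \<and> (\<forall>z\<in>U. F z = 0)" for v
    using smooth_frechet_derivative[OF F(2), of v]
    by (intro exI[of _ "\<lambda>z. frechet_derivative F (at z) v"]) auto
  moreover have "g differentiable at z" for z
    using der unfolding F(1) differentiable_def by blast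
  ultimately show "(\<forall>z. g differentiable at z) \<and> (\<forall>v. \<exists>F. (\<lambda>z. frechet_derivative g (at z) v) =
      (\<lambda>z. indicator R z * F z) \<and> smooth F \<and> (\<forall>z\<in>U. F z = 0))"
    by blast
qed (rule exI[of _ F], use assms in simp)

subsection \<open>Weak derivatives of functions supported in a box\<close>

lemma set_integrable_box:
  fixes F :: "'a::euclidean_space \<Rightarrow> real"
  assumes "continuous_on UNIV F"
  shows "set_integrable lborel (box p q) F"
proof -
  have "set_integrable lborel (cbox p q) F"
    unfolding set_integrable_def
    by (rule borel_integrable_compact) (auto intro: continuous_on_subset[OF assms])
  then show ?thesis
    by (rule set_integrable_subset) (auto simp: box_subset_cbox)
qed

text \<open>The boundary of a box does not affect the integral. This passes to the gauge integral
  over the closed box, for which Fubini and the fundamental theorem of calculus are at hand.\<close>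

lemma set_integral_box:
  fixes F :: "'a::euclidean_space \<Rightarrow> real"
  assumes "continuous_on UNIV F"
  shows "(LINT z:box p q|lborel. F z) = integral (cbox p q) F"
  using set_borel_integral_eq_integral(2)[OF set_integrable_box[OF assms]]
  by (simp add: integral_open_interval)

lemma integrable_on_cbox:
  fixes F :: "'a::euclidean_space \<Rightarrow> real"
  assumes "continuous_on UNIV F"
  shows "F integrable_on cbox p q"
  by (rule integrable_continuous) (rule continuous_on_subset[OF assms subset_UNIV])

lemma L2_inner_indicator:
  assumes "box p q \<subseteq> D" "continuous_on UNIV F" "continuous_on UNIV G"
  shows "L2_inner D (\<lambda>z. indicator (box p q) z * F z) G = integral (cbox p q) (\<lambda>z. F z * G z)"
proof -
  have "L2_inner D (\<lambda>z. indicator (box p q) z * F z) G = (LINT z:box p q|lborel. F z * G z)"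
    unfolding L2_inner_def set_lebesgue_integral_def
    by (rule Bochner_Integration.integral_cong) (use assms(1) in \<open>auto simp: indicator_def\<close>)
  also have "\<dots> = integral (cbox p q) (\<lambda>z. F z * G z)"
    by (intro set_integral_box continuous_on_mult assms)
  finally show ?thesis .
qed

lemma L2_inner_indicator2:
  assumes "box p q \<subseteq> D" "continuous_on UNIV F" "continuous_on UNIV G"
  shows "L2_inner D (\<lambda>z. indicator (box p q) z * F z) (\<lambda>z. indicator (box p q) z * G z) =
    integral (cbox p q) (\<lambda>z. F z * G z)"
proof -
  have "L2_inner D (\<lambda>z. indicator (box p q) z * F z) (\<lambda>z. indicator (box p q) z * G z) =
      L2_inner D (\<lambda>z. indicator (box p q) z * F z) G"
    unfolding L2_inner_def set_lebesgue_integral_def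
    by (rule Bochner_Integration.integral_cong) (auto simp: indicator_def)
  then show ?thesis using L2_inner_indicator[OF assms] by simp
qed

lemma L2_norm_eq_sqrt_inner: "L2_norm D u = sqrt (L2_inner D u u)"
  by (simp add: L2_norm_def L2_inner_def power2_eq_square)

lemma L2_norm_indicator:
  assumes "box p q \<subseteq> D" "continuous_on UNIV F"
  shows "L2_norm D (\<lambda>z. indicator (box p q) z * F z) = sqrt (integral (cbox p q) (\<lambda>z. (F z)\<^sup>2))"
  by (simp add: L2_norm_eq_sqrt_inner L2_inner_indicator2 assms power2_eq_square)

lemma L2_functions_indicator:
  assumes "box p q \<subseteq> D" "D \<in> sets borel" "continuous_on UNIV F"
  shows "(\<lambda>z. indicator (box p q) z * F z) \<in> L2_functions D"
proof -
  have [measurable]: "F \<in> borel_measurable borel" "D \<in> sets borel"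
    using assms by (auto intro: borel_measurable_continuous_onI)
  have "set_integrable lborel (box p q) (\<lambda>z. (F z)\<^sup>2)"
    by (intro set_integrable_box continuous_intros assms)
  also have "?this \<longleftrightarrow> set_integrable lborel D (\<lambda>z. (indicator (box p q) z * F z)\<^sup>2)"
    unfolding set_integrable_def
    by (rule Bochner_Integration.integrable_cong) (use assms(1) in \<open>auto simp: indicator_def\<close>)
  finally show ?thesis
    by (simp add: L2_functions_def set_borel_measurable_def)
qed

lemma mem_box_pair:
  fixes x y a b c d :: real
  shows "(x, y) \<in> box (a, c) (b, d) \<longleftrightarrow> a < x \<and> x < b \<and> c < y \<and> y < d"
  by (auto simp: mem_box Basis_prod_def)

text \<open>Fubini puts the integration in \<open>x\<close> innermost, and there the fundamental
  theorem gives \<open>G (b, y) - G (a, y)\<close>. This is integration by parts without boundary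
  contribution.\<close>

lemma integral_x_derivative_eq_0:
  fixes G G' :: "real \<times> real \<Rightarrow> real"
  assumes "a \<le> b" "continuous_on UNIV G'"
    and "\<And>x y. ((\<lambda>t. G (t, y)) has_real_derivative G' (x, y)) (at x)"
    and "\<And>y. y \<in> {c..d} \<Longrightarrow> G (a, y) = G (b, y)"
  shows "integral (cbox (a, c) (b, d)) G' = 0"
proof -
  have cont: "continuous_on A G'" for A
    by (rule continuous_on_subset[OF assms(2)]) simp
  have "integral (cbox (a, c) (b, d)) G' = integral (cbox a b) (\<lambda>x. integral (cbox c d) (\<lambda>y. G' (x, y)))"
    by (rule integral_prod_continuous) (rule cont)
  also have "\<dots> = integral (cbox c d) (\<lambda>y. integral (cbox a b) (\<lambda>x. G' (x, y)))"
    by (rule integral_swap_continuous) (simp add: case_prod_unfold cont)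
  also have "\<dots> = integral (cbox c d) (\<lambda>y. 0)"
  proof (rule Henstock_Kurzweil_Integration.integral_cong)
    fix y assume y: "y \<in> cbox c d"
    have "((\<lambda>x. G' (x, y)) has_integral (G (b, y) - G (a, y))) {a..b}"
      using assms(1,3)
      by (intro fundamental_theorem_of_calculus)
         (auto simp: has_real_derivative_iff_has_vector_derivative[symmetric] intro: DERIV_subset)
    then show "integral (cbox a b) (\<lambda>x. G' (x, y)) = 0"
      using assms(4) y by (simp add: integral_unique)
  qed
  finally show ?thesis by simp
qed

lemma integral_y_derivative_eq_0:
  fixes G G' :: "real \<times> real \<Rightarrow> real"
  assumes "c \<le> d" "continuous_on UNIV G'"
    and "\<And>x y. ((\<lambda>t. G (x, t)) has_real_derivative G' (x, y)) (at y)"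
    and "\<And>x. x \<in> {a..b} \<Longrightarrow> G (x, c) = G (x, d)"
  shows "integral (cbox (a, c) (b, d)) G' = 0"
proof -
  have cont: "continuous_on A G'" for A
    by (rule continuous_on_subset[OF assms(2)]) simp
  have "integral (cbox (a, c) (b, d)) G' = integral (cbox a b) (\<lambda>x. integral (cbox c d) (\<lambda>y. G' (x, y)))"
    by (rule integral_prod_continuous) (rule cont)
  also have "\<dots> = integral (cbox a b) (\<lambda>x. 0)"
  proof (rule Henstock_Kurzweil_Integration.integral_cong)
    fix x assume x: "x \<in> cbox a b"
    have "((\<lambda>y. G' (x, y)) has_integral (G (x, d) - G (x, c))) {c..d}"
      using assms(1,3)
      by (intro fundamental_theorem_of_calculus)
         (auto simp: has_real_derivative_iff_has_vector_derivative[symmetric] intro: DERIV_subset)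
    then show "integral (cbox c d) (\<lambda>y. G' (x, y)) = 0"
      using assms(4) x by (simp add: integral_unique)
  qed
  finally show ?thesis by simp
qed

lemma smooth_laplacian_continuous: "smooth P \<Longrightarrow> continuous_on UNIV (laplacian P)"
  unfolding laplacian_def[abs_def]
  by (intro continuous_on_add smooth_continuous_on smooth_partial_x smooth_partial_y)

lemma test_functions_smooth: "\<phi> \<in> test_functions D \<Longrightarrow> smooth \<phi>"
  by (simp add: test_functions_def smooth_def)

lemma test_functions_eq_0: "\<phi> \<in> test_functions D \<Longrightarrow> z \<notin> D \<Longrightarrow> \<phi> z = 0"
  using closure_subset[of "{z. \<phi> z \<noteq> 0}"] by (auto simp: test_functions_def)

text \<open>Integration by parts on the rectangle. Every boundary term contains the factor
  \<open>P\<close>, which is 0 on the four edges, so nothing is asked of the test function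
  there.\<close>

lemma weak_gradient_box:
  assumes "a \<le> b" "c \<le> d" "box (a, c) (b, d) \<subseteq> D" "D \<in> sets borel" "smooth P"
    and zero: "\<And>z. z \<in> cbox (a, c) (b, d) - box (a, c) (b, d) \<Longrightarrow> P z = 0"
  shows "weak_gradient D (\<lambda>z. indicator (box (a, c) (b, d)) z * P z)
    (\<lambda>z. indicator (box (a, c) (b, d)) z * partial_x P z)
    (\<lambda>z. indicator (box (a, c) (b, d)) z * partial_y P z)"
proof -
  let ?Q = "cbox (a, c) (b, d)"
  note smooth = smooth_partial_x smooth_partial_y \<open>smooth P\<close>
  have edges: "\<And>y. y \<in> {c..d} \<Longrightarrow> P (a, y) = 0" "\<And>y. y \<in> {c..d} \<Longrightarrow> P (b, y) = 0"
    "\<And>x. x \<in> {a..b} \<Longrightarrow> P (x, c) = 0" "\<And>x. x \<in> {a..b} \<Longrightarrow> P (x, d) = 0"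
    using assms(1,2) by (auto intro!: zero simp: mem_box_pair)
  have "integral ?Q (\<lambda>z. P z * partial_x \<phi> z) = - integral ?Q (\<lambda>z. partial_x P z * \<phi> z)"
    and "integral ?Q (\<lambda>z. P z * partial_y \<phi> z) = - integral ?Q (\<lambda>z. partial_y P z * \<phi> z)"
    if "smooth \<phi>" for \<phi>
  proof -
    have "integral ?Q (\<lambda>z. partial_x P z * \<phi> z + P z * partial_x \<phi> z) = 0"
    proof (rule integral_x_derivative_eq_0[of _ _ _ "\<lambda>z. P z * \<phi> z"])
      show "continuous_on UNIV (\<lambda>z. partial_x P z * \<phi> z + P z * partial_x \<phi> z)"
        by (intro continuous_intros smooth_continuous_on smooth that)
    qed (use assms(1) edges in \<open>auto intro!: derivative_eq_intros partial_x_has_derivative smooth that\<close>)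
    also have "integral ?Q (\<lambda>z. partial_x P z * \<phi> z + P z * partial_x \<phi> z) =
        integral ?Q (\<lambda>z. partial_x P z * \<phi> z) + integral ?Q (\<lambda>z. P z * partial_x \<phi> z)"
      by (intro Henstock_Kurzweil_Integration.integral_add integrable_on_cbox continuous_intros smooth_continuous_on smooth that)
    finally show "integral ?Q (\<lambda>z. P z * partial_x \<phi> z) = - integral ?Q (\<lambda>z. partial_x P z * \<phi> z)"
      by simp
    have "integral ?Q (\<lambda>z. partial_y P z * \<phi> z + P z * partial_y \<phi> z) = 0"
    proof (rule integral_y_derivative_eq_0[of _ _ _ "\<lambda>z. P z * \<phi> z"])
      show "continuous_on UNIV (\<lambda>z. partial_y P z * \<phi> z + P z * partial_y \<phi> z)"
        by (intro continuous_intros smooth_continuous_on smooth that)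
    qed (use assms(2) edges in \<open>auto intro!: derivative_eq_intros partial_y_has_derivative smooth that\<close>)
    also have "integral ?Q (\<lambda>z. partial_y P z * \<phi> z + P z * partial_y \<phi> z) =
        integral ?Q (\<lambda>z. partial_y P z * \<phi> z) + integral ?Q (\<lambda>z. P z * partial_y \<phi> z)"
      by (intro Henstock_Kurzweil_Integration.integral_add integrable_on_cbox continuous_intros smooth_continuous_on smooth that)
    finally show "integral ?Q (\<lambda>z. P z * partial_y \<phi> z) = - integral ?Q (\<lambda>z. partial_y P z * \<phi> z)"
      by simp
  qed
  then show ?thesis
    unfolding weak_gradient_def
    by (auto simp: L2_inner_indicator assms smooth_continuous_on smooth test_functions_smooth
        intro!: L2_functions_indicator subsetD[OF assms(3)])
qed

text \<open>Green's identity. The vertical edges may run inside \<open>D\<close>, where test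
  functions are unrestricted, so both \<open>P\<close> and its normal derivative have to vanish
  there. On the horizontal edges only \<open>P\<close> is assumed to vanish; the term with its
  normal derivative disappears because the test function is 0 outside \<open>D\<close>.\<close>

lemma weak_laplacian_box:
  assumes "a \<le> b" "c \<le> d" "box (a, c) (b, d) \<subseteq> D" "D \<in> sets borel" "smooth P"
    and zero: "\<And>z. z \<in> cbox (a, c) (b, d) - box (a, c) (b, d) \<Longrightarrow> P z = 0"
    and zero_x: "\<And>y. partial_x P (a, y) = 0" "\<And>y. partial_x P (b, y) = 0"
    and bdry: "\<And>x. x \<in> {a..b} \<Longrightarrow> (x, c) \<notin> D" "\<And>x. x \<in> {a..b} \<Longrightarrow> (x, d) \<notin> D"
  shows "weak_laplacian D (\<lambda>z. indicator (box (a, c) (b, d)) z * P z)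
    (\<lambda>z. indicator (box (a, c) (b, d)) z * laplacian P z)"
proof -
  let ?Q = "cbox (a, c) (b, d)"
  note smooth = smooth_partial_x smooth_partial_y \<open>smooth P\<close>
  have edges: "\<And>y. y \<in> {c..d} \<Longrightarrow> P (a, y) = 0" "\<And>y. y \<in> {c..d} \<Longrightarrow> P (b, y) = 0"
    "\<And>x. x \<in> {a..b} \<Longrightarrow> P (x, c) = 0" "\<And>x. x \<in> {a..b} \<Longrightarrow> P (x, d) = 0"
    using assms(1,2) by (auto intro!: zero simp: mem_box_pair)
  have "integral ?Q (\<lambda>z. P z * laplacian \<phi> z) = integral ?Q (\<lambda>z. laplacian P z * \<phi> z)"
    if \<phi>: "\<phi> \<in> test_functions D" for \<phi>
  proof -
    note sm = smooth test_functions_smooth[OF \<phi>]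
    \<comment> \<open>Both are exact derivatives: when
      \<open>P * partial_x \<phi> - partial_x P * \<phi>\<close> is differentiated in
      \<open>x\<close>, the products of first derivatives cancel, and likewise in
      \<open>y\<close>.\<close>
    let ?X = "\<lambda>z. P z * partial_x (partial_x \<phi>) z - partial_x (partial_x P) z * \<phi> z"
    let ?Y = "\<lambda>z. P z * partial_y (partial_y \<phi>) z - partial_y (partial_y P) z * \<phi> z"
    have X: "integral ?Q ?X = 0"
    proof (rule integral_x_derivative_eq_0[of _ _ _ "\<lambda>z. P z * partial_x \<phi> z - partial_x P z * \<phi> z"])
      show "continuous_on UNIV ?X"
        by (intro continuous_intros smooth_continuous_on sm )
    qed (use assms(1) edges zero_x in \<open>auto intro!: derivative_eq_intros partial_x_has_derivative sm\<close>)
    have Y: "integral ?Q ?Y = 0"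
    proof (rule integral_y_derivative_eq_0[of _ _ _ "\<lambda>z. P z * partial_y \<phi> z - partial_y P z * \<phi> z"])
      show "continuous_on UNIV ?Y"
        by (intro continuous_intros smooth_continuous_on sm )
    qed (use assms(2) edges bdry test_functions_eq_0[OF \<phi>] in \<open>auto intro!: derivative_eq_intros partial_y_has_derivative sm\<close>)
    have "integral ?Q (\<lambda>z. P z * laplacian \<phi> z) - integral ?Q (\<lambda>z. laplacian P z * \<phi> z) =
        integral ?Q (\<lambda>z. P z * laplacian \<phi> z - laplacian P z * \<phi> z)"
      by (intro Henstock_Kurzweil_Integration.integral_diff[symmetric] integrable_on_cbox
            continuous_intros smooth_continuous_on smooth_laplacian_continuous sm)
    also have "\<dots> = integral ?Q (\<lambda>z. ?X z + ?Y z)"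
      by (simp add: laplacian_def algebra_simps)
    also have "\<dots> = integral ?Q ?X + integral ?Q ?Y"
      by (intro Henstock_Kurzweil_Integration.integral_add integrable_on_cbox
            continuous_intros smooth_continuous_on sm)
    finally show ?thesis using X Y by simp
  qed
  then show ?thesis
    unfolding weak_laplacian_def
    by (auto simp: L2_inner_indicator assms smooth_continuous_on smooth smooth_laplacian_continuous
        test_functions_smooth intro!: L2_functions_indicator subsetD[OF assms(3)])
qed

section \<open>Approximation by test functions and membership in \<open>H1_0\<close>\<close>

text \<open>Dominated convergence for the squares: the box is bounded, so the square of the
  continuous majorant \<open>w\<close> is integrable on it.\<close>

lemma L2_norm_indicator_tendsto_0:
  fixes u v :: "nat \<Rightarrow> real \<times> real \<Rightarrow> real"
  assumes "box p q \<subseteq> D" "D \<in> sets borel"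
    and cont: "\<And>k. continuous_on UNIV (u k)" "continuous_on UNIV w"
    and bound: "\<And>k z. \<bar>u k z\<bar> \<le> w z"
    and lim: "AE z in lborel. (\<lambda>k. u k z) \<longlonglongrightarrow> 0"
  shows "(\<lambda>k. L2_norm D (\<lambda>z. indicator (box p q) z * u k z)) \<longlonglongrightarrow> 0"
proof -
  have [measurable]: "u k \<in> borel_measurable borel" "w \<in> borel_measurable borel" for k
    using cont by (auto intro: borel_measurable_continuous_onI)
  have "(\<lambda>k. LINT z|lborel. indicator (box p q) z * (u k z)\<^sup>2) \<longlonglongrightarrow> (LINT z|(lborel :: (real \<times> real) measure). 0)"
  proof (rule integral_dominated_convergence)
    show "integrable lborel (\<lambda>z. indicator (box p q) z * (w z)\<^sup>2)"
      using set_integrable_box[of "\<lambda>z. (w z)\<^sup>2" p q] cont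
      by (auto simp: set_integrable_def intro!: continuous_intros)
    show "AE z in lborel. (\<lambda>k. indicator (box p q) z * (u k z)\<^sup>2) \<longlonglongrightarrow> 0"
      using lim
    proof eventually_elim
      case (elim z)
      have "(\<lambda>k. indicator (box p q) z * (u k z)\<^sup>2) \<longlonglongrightarrow> indicator (box p q) z * 0\<^sup>2"
        by (intro tendsto_intros elim)
      then show ?case by simp
    qed
    show "AE z in lborel. norm (indicator (box p q) z * (u k z)\<^sup>2) \<le> indicator (box p q) z * (w z)\<^sup>2" for k
    proof (rule AE_I2)
      fix z
      show "norm (indicator (box p q) z * (u k z)\<^sup>2) \<le> indicator (box p q) z * (w z)\<^sup>2"
        using power_mono[OF bound[of k z] abs_ge_zero, of 2] by (simp add: indicator_def)
    qed
  qed auto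
  moreover have "integral (cbox p q) (\<lambda>z. (u k z)\<^sup>2) = (LINT z|lborel. indicator (box p q) z * (u k z)\<^sup>2)" for k
    using set_integral_box[OF continuous_on_power[OF cont(1)[of k]], of p q 2]
    by (simp add: set_lebesgue_integral_def)
  ultimately have "(\<lambda>k. sqrt (integral (cbox p q) (\<lambda>z. (u k z)\<^sup>2))) \<longlonglongrightarrow> sqrt 0"
    by (intro tendsto_real_sqrt) simp
  then show ?thesis
    using assms by (simp add: L2_norm_indicator)
qed

text \<open>With \<open>q = N * p\<^sup>2\<close> this is the derivative in \<open>p\<close> of the
  cut-off \<open>p * flat 1 (N * p\<^sup>2 - 1)\<close>. It depends on \<open>q\<close> alone, so
  its bounds do not depend on \<open>N\<close>.\<close>

definition cutoff_slope :: "real \<Rightarrow> real" where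
  "cutoff_slope q = flat 1 (q - 1) + 2 * q * flat [:0, 0, 1:] (q - 1)"

lemma flat_1_bounds: "0 \<le> flat 1 s" "flat 1 s \<le> 1"
  by (auto simp: flat_def)

text \<open>The uniform bound supplies the majorant for dominated convergence. For
  \<open>q > 1\<close> and \<open>r = 1 / (q - 1)\<close> the second summand equals
  \<open>2 * (r\<^sup>2 + r) * exp (- r)\<close>, which the quadratic Taylor bound keeps below 6,
  and the first is at most 1. For \<open>q \<le> 1\<close> the slope is 0.\<close>

lemma abs_cutoff_slope_minus_1_le: "\<bar>cutoff_slope q - 1\<bar> \<le> 7"
proof (cases "q > 1")
  case True
  define r where "r = 1 / (q - 1)"
  have r: "r > 0" and q: "q = 1 + 1 / r" using True by (auto simp: r_def field_simps)
  have "2 * q * flat [:0, 0, 1:] (q - 1) = 2 * (r\<^sup>2 + r) * exp (- r)"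
    using r by (simp add: q flat_def field_simps power2_eq_square)
  moreover have "r\<^sup>2 + r \<le> 3 * exp r"
    using exp_lower_Taylor_quadratic[of r] r zero_le_power2[of r] by linarith
  then have "2 * (r\<^sup>2 + r) * exp (- r) \<le> 6"
    by (simp add: exp_minus field_simps)
  moreover have "2 * (r\<^sup>2 + r) * exp (- r) \<ge> 0" using r by simp
  ultimately show ?thesis
    unfolding cutoff_slope_def using flat_1_bounds[of "q - 1"] by linarith
qed (simp add: cutoff_slope_def flat_def)

lemma flat_1_tendsto_1: "((\<lambda>q. flat 1 (q - 1)) \<longlongrightarrow> 1) at_top"
proof (rule Lim_transform_eventually)
  show "((\<lambda>q::real. exp (- 1 / (q - 1))) \<longlongrightarrow> 1) at_top" by real_asymp
  show "eventually (\<lambda>q. exp (- 1 / (q - 1)) = flat 1 (q - 1)) at_top"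
    using eventually_gt_at_top[of 1] by eventually_elim (simp add: flat_def)
qed

lemma cutoff_slope_tendsto_1: "(cutoff_slope \<longlongrightarrow> 1) at_top"
proof (rule Lim_transform_eventually)
  show "((\<lambda>q::real. exp (- 1 / (q - 1)) + 2 * q * ((1 / (q - 1))\<^sup>2 * exp (- 1 / (q - 1)))) \<longlongrightarrow> 1) at_top"
    by real_asymp
  show "eventually (\<lambda>q. exp (- 1 / (q - 1)) + 2 * q * ((1 / (q - 1))\<^sup>2 * exp (- 1 / (q - 1))) = cutoff_slope q) at_top"
    using eventually_gt_at_top[of 1]
    by eventually_elim (simp add: cutoff_slope_def flat_def power2_eq_square)
qed

text \<open>The functions \<open>P * exp (- 1 / (N * P\<^sup>2 - 1))\<close>, set to 0 where \<open>N * P\<^sup>2 \<le> 1\<close>, are smooth,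
  vanish near the zeros of \<open>P\<close> and converge to \<open>P\<close> as \<open>N \<rightarrow> \<infinity>\<close>.\<close>

lemma H1_0_box:
  assumes ab: "a \<le> b" "c \<le> d" and box: "box (a, c) (b, d) \<subseteq> D" and "open D"
    and P: "trig_flat P"
    and zero: "\<And>z. z \<in> cbox (a, c) (b, d) - box (a, c) (b, d) \<Longrightarrow> P z = 0"
    and nonzero: "AE z in lborel. P z \<noteq> 0"
  shows "(\<lambda>z. indicator (box (a, c) (b, d)) z * P z) \<in> H1_0 D"
proof -
  let ?R = "box (a, c) (b, d)"
  define N where "N k = (real k + 1)\<^sup>2" for k
  define F where "F k z = P z * flat 1 (N k * (P z)\<^sup>2 - 1)" for k z
  define \<Phi> where "\<Phi> k z = indicator ?R z * F k z" for k z
  have D: "D \<in> sets borel" using \<open>open D\<close> by simp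
  have smP: "smooth P" using P by (rule smooth_trig_flat)
  have contP: "continuous_on A P" for A by (rule smooth_continuous_on[OF smP])
  have "trig_flat (\<lambda>z. P z * flat 1 (N k * (P z * P z) + (- 1)))" for k
    by (intro trig_flat.intros P)
  then have smF: "smooth (F k)" for k
    by (intro smooth_trig_flat) (simp add: F_def[abs_def] power2_eq_square)

  \<comment> \<open>On \<open>U k\<close> the cut-off is switched off. This open set contains the
    frontier of the box, where \<open>P\<close> is 0, so the indicator can be inserted without
    losing smoothness.\<close>
  define U where "U k = {z. N k * (P z)\<^sup>2 < 1}" for k
  have U1: "open (U k)" for k
    unfolding U_def by (intro open_Collect_less continuous_intros contP)
  have U2: "frontier ?R \<subseteq> U k" for k
    using zero by (auto simp: frontier_box U_def split: if_splits)
  have U3: "F k z = 0" if "z \<in> U k" for k z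
    using that by (simp add: F_def U_def flat_def)
  have sm\<Phi>: "smooth (\<Phi> k)"
    and der\<Phi>: "((\<Phi> k) has_derivative (\<lambda>v. indicator ?R z * frechet_derivative (F k) (at z) v)) (at z)" for k z
    unfolding \<Phi>_def[abs_def]
    by (rule smooth_indicator_times[OF smF U1 U2 U3] indicator_times_has_derivative[OF smF U1 U2 U3]; assumption)+

  \<comment> \<open>The non-strict inequality defines a closed set, so it survives on the closure of
    the support. It excludes the zeros of \<open>P\<close>, hence the edges of the box, and keeps
    the support inside the open box.\<close>
  have "closure {z. \<Phi> k z \<noteq> 0} \<subseteq> cbox (a, c) (b, d) \<inter> {z. 1 \<le> N k * (P z)\<^sup>2}" for k
  proof (rule closure_minimal)
    show "{z. \<Phi> k z \<noteq> 0} \<subseteq> cbox (a, c) (b, d) \<inter> {z. 1 \<le> N k * (P z)\<^sup>2}"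
      using box_subset_cbox[of "(a, c)" "(b, d)"] by (auto simp: \<Phi>_def F_def flat_def indicator_def split: if_splits)
    show "closed (cbox (a, c) (b, d) \<inter> {z. 1 \<le> N k * (P z)\<^sup>2})"
      by (intro closed_Int closed_cbox closed_Collect_le continuous_intros contP)
  qed
  moreover have "cbox (a, c) (b, d) \<inter> {z. 1 \<le> N k * (P z)\<^sup>2} \<subseteq> D" for k
    using zero box by fastforce
  ultimately have "\<Phi> k \<in> test_functions D" for k
    using sm\<Phi> bounded_subset[OF bounded_cbox, of "closure {z. \<Phi> k z \<noteq> 0}" "(a, c)" "(b, d)"]
    unfolding test_functions_def smooth_def compact_eq_bounded_closed by blast

  have "(F k has_derivative (\<lambda>v. frechet_derivative P (at z) v * cutoff_slope (N k * (P z)\<^sup>2))) (at z)" for k z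
  proof -
    note dP = smooth_has_derivative[OF smP, of z]
    have "((\<lambda>z. N k * (P z)\<^sup>2 - 1) has_derivative (\<lambda>v. N k * (2 * P z * frechet_derivative P (at z) v))) (at z)"
      by (rule derivative_eq_intros dP refl)+ (auto simp: mult_ac)
    moreover have "(flat 1 has_derivative (\<lambda>t. flat [:0, 0, 1:] s * t)) (at s)" for s
      using flat_has_derivative[of 1 s] by (simp add: has_field_derivative_def)
    ultimately have "((\<lambda>z. flat 1 (N k * (P z)\<^sup>2 - 1)) has_derivative (\<lambda>v. flat [:0, 0, 1:] (N k * (P z)\<^sup>2 - 1) *
        (N k * (2 * P z * frechet_derivative P (at z) v)))) (at z)"
      by (rule has_derivative_compose)
    from has_derivative_mult[OF dP this] show ?thesis
      unfolding F_def[abs_def]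
      by (rule has_derivative_eq_rhs) (auto simp: cutoff_slope_def algebra_simps power2_eq_square)
  qed
  then have "frechet_derivative (F k) (at z) = (\<lambda>v. frechet_derivative P (at z) v * cutoff_slope (N k * (P z)\<^sup>2))" for k z
    by (rule frechet_derivative_at[symmetric])
  moreover have "frechet_derivative (\<Phi> k) (at z) = (\<lambda>v. indicator ?R z * frechet_derivative (F k) (at z) v)" for k z
    using der\<Phi> by (rule frechet_derivative_at[symmetric])
  ultimately have px: "partial_x (\<Phi> k) z = indicator ?R z * (partial_x P z * cutoff_slope (N k * (P z)\<^sup>2))"
    and py: "partial_y (\<Phi> k) z = indicator ?R z * (partial_y P z * cutoff_slope (N k * (P z)\<^sup>2))" for k z
    by (auto simp: partial_x_def partial_y_def)

  have grow: "filterlim (\<lambda>k. N k * (P z)\<^sup>2) at_top sequentially" if "P z \<noteq> 0" for z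
  proof -
    have "(P z)\<^sup>2 > 0" using that by simp
    then show ?thesis unfolding N_def by real_asymp
  qed
  have lim: "(\<lambda>k. flat 1 (N k * (P z)\<^sup>2 - 1)) \<longlonglongrightarrow> 1" "(\<lambda>k. cutoff_slope (N k * (P z)\<^sup>2)) \<longlonglongrightarrow> 1"
    if "P z \<noteq> 0" for z
    by (rule filterlim_compose[OF flat_1_tendsto_1 grow[OF that]]
        filterlim_compose[OF cutoff_slope_tendsto_1 grow[OF that]])+

  \<comment> \<open>One argument serves \<open>P\<close> and both its partial derivatives: each is
    multiplied by factors that stay within 7 of 1 and tend to 1 off the zeros of \<open>P\<close>,
    hence almost everywhere.\<close>
  have *: "(\<lambda>k. L2_norm D (\<lambda>z. indicator ?R z * (G z * q k z - G z))) \<longlonglongrightarrow> 0"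
    if G: "continuous_on UNIV G" and q: "\<And>k. continuous_on UNIV (\<lambda>z. G z * q k z)"
      and bound: "\<And>k z. \<bar>q k z - 1\<bar> \<le> 7" and lim: "\<And>z. P z \<noteq> 0 \<Longrightarrow> (\<lambda>k. q k z) \<longlonglongrightarrow> 1" for G q
  proof (rule L2_norm_indicator_tendsto_0[OF box D, where w = "\<lambda>z. \<bar>G z\<bar> * 7"])
    show "\<bar>G z * q k z - G z\<bar> \<le> \<bar>G z\<bar> * 7" for k z
      using mult_left_mono[OF bound[of k z] abs_ge_zero[of "G z"]]
      by (simp add: abs_mult[symmetric] right_diff_distrib)
    show "AE z in lborel. (\<lambda>k. G z * q k z - G z) \<longlonglongrightarrow> 0"
      using nonzero
    proof eventually_elim
      case (elim z)
      have "(\<lambda>k. G z * q k z - G z) \<longlonglongrightarrow> G z * 1 - G z"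
        by (intro tendsto_intros lim elim)
      then show ?case by simp
    qed
  qed (intro continuous_intros G q)+

  have flat_cont: "continuous_on UNIV (\<lambda>z. flat p (N k * (P z)\<^sup>2 - 1))" for p k
  proof (rule continuous_on_compose2[of UNIV "flat p"])
    show "continuous_on UNIV (flat p)"
      by (rule DERIV_continuous_on) (rule flat_has_derivative)
  qed (auto intro!: continuous_intros contP)
  have slope: "continuous_on UNIV (\<lambda>z. G z * cutoff_slope (N k * (P z)\<^sup>2))" if "smooth G" for G k
    unfolding cutoff_slope_def
    by (intro continuous_intros flat_cont contP smooth_continuous_on[OF that])
  have smx: "smooth (partial_x P)" and smy: "smooth (partial_y P)"
    by (intro smooth_partial_x smooth_partial_y smP)+
  have "(\<lambda>k. L2_norm D (\<lambda>z. \<Phi> k z - indicator ?R z * P z)) \<longlonglongrightarrow> 0"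
  proof -
    have "\<bar>flat 1 s - 1\<bar> \<le> 7" for s
      using flat_1_bounds[of s] by linarith
    from *[of P "\<lambda>k z. flat 1 (N k * (P z)\<^sup>2 - 1)", OF contP _ this lim(1)]
    show ?thesis
      by (simp add: \<Phi>_def F_def right_diff_distrib continuous_on_mult contP flat_cont)
  qed
  moreover have "(\<lambda>k. L2_norm D (\<lambda>z. partial_x (\<Phi> k) z - indicator ?R z * partial_x P z)) \<longlonglongrightarrow> 0"
    using *[OF smooth_continuous_on[OF smx] slope[OF smx] abs_cutoff_slope_minus_1_le lim(2)]
    by (simp add: px right_diff_distrib)
  moreover have "(\<lambda>k. L2_norm D (\<lambda>z. partial_y (\<Phi> k) z - indicator ?R z * partial_y P z)) \<longlonglongrightarrow> 0"
    using *[OF smooth_continuous_on[OF smy] slope[OF smy] abs_cutoff_slope_minus_1_le lim(2)]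
    by (simp add: py right_diff_distrib)
  moreover have "(\<lambda>z. indicator ?R z * P z) \<in> L2_functions D"
    by (intro L2_functions_indicator box D contP)
  ultimately show ?thesis
    unfolding H1_0_def mem_Collect_eq
    using weak_gradient_box[OF ab box D smP zero] \<open>\<And>k. \<Phi> k \<in> test_functions D\<close>
    by (intro conjI exI[of _ \<Phi>] exI[of _ "\<lambda>z. indicator ?R z * partial_x P z"]
        exI[of _ "\<lambda>z. indicator ?R z * partial_y P z"]) auto
qed

subsection \<open>Quasimodes of a strip\<close>

text \<open>The interval holds \<open>j\<close> half periods, so the sine in the antiderivative
  vanishes at both ends. All orthogonality relations below reduce to this.\<close>

lemma has_integral_cos:
  assumes "l > 0"
  shows "((\<lambda>x. cos (of_int j * (pi / l * (x - a)))) has_integral (if j = 0 then l else 0)) {a..a + l}"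
proof (cases "j = 0")
  case True
  then show ?thesis using assms has_integral_const_real[of "1::real" a "a + l"] by simp
next
  case False
  define k where "k = of_int j * (pi / l)"
  have k: "k \<noteq> 0" using False assms by (simp add: k_def)
  have "((\<lambda>x. cos (k * (x - a))) has_integral (sin (k * (a + l - a)) / k - sin (k * (a - a)) / k)) {a..a + l}"
    using assms k
    by (intro fundamental_theorem_of_calculus)
       (auto simp: has_real_derivative_iff_has_vector_derivative[symmetric] intro!: derivative_eq_intros)
  moreover have "sin (k * (a + l - a)) = 0"
    using assms by (simp add: k_def sin_times_pi_eq_0)
  ultimately show ?thesis
    using False by (simp add: k_def mult.assoc)
qed

lemma has_integral_sin_sin:
  fixes n n' :: nat
  assumes "l > 0" "n \<ge> 1" "n' \<ge> 1"
  shows "((\<lambda>y. sin (real n * (pi / l * (y - a))) * sin (real n' * (pi / l * (y - a))))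
    has_integral (if n = n' then l / 2 else 0)) {a..a + l}"
proof -
  let ?c = "\<lambda>j x. cos (of_int j * (pi / l * (x - a)))"
  have "((\<lambda>x. (?c (int n - int n') x - ?c (int n + int n') x) / 2) has_integral
      ((if int n - int n' = 0 then l else 0) - (if int n + int n' = 0 then l else 0)) / 2) {a..a + l}"
    by (intro has_integral_divide has_integral_diff has_integral_cos assms)
  also have "(\<lambda>x. (?c (int n - int n') x - ?c (int n + int n') x) / 2) =
      (\<lambda>y. sin (real n * (pi / l * (y - a))) * sin (real n' * (pi / l * (y - a))))"
    unfolding sin_times_sin
    by (simp only: of_int_diff of_int_add of_int_of_nat_eq left_diff_distrib distrib_right)
  finally show ?thesis using assms by (auto split: if_splits)
qed

text \<open>The second factor \<open>sin t\<close> makes the first derivative vanish at both ends as well, so that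
  the extension by 0 has a square integrable second derivative.\<close>

definition profile :: "nat \<Rightarrow> real \<Rightarrow> real" where
  "profile m t = sin t * sin (real m * t)"

text \<open>The square of \<open>sin t\<close> is \<open>(1 - cos (2 * t)) / 2\<close>, and the
  products are then turned into sums. Integer frequencies let \<open>has_integral_cos\<close>
  integrate the result term by term.\<close>

lemma profile_mult:
  "profile m t * profile m' t =
    (cos (of_int (int m - int m') * t) - cos (of_int (int m + int m') * t)) / 4
    - (cos (of_int (int m - int m' + 2) * t) + cos (of_int (int m - int m' - 2) * t)) / 8
    + (cos (of_int (int m + int m' + 2) * t) + cos (of_int (int m + int m' - 2) * t)) / 8"
proof -
  define p q where "p = (real m - real m') * t" and "q = (real m + real m') * t"
  have "profile m t * profile m' t = (sin t)\<^sup>2 * (sin (real m * t) * sin (real m' * t))"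
    by (simp add: profile_def power2_eq_square)
  also have "\<dots> = (1 - cos (2 * t)) / 2 * ((cos p - cos q) / 2)"
    by (simp add: cos_double_sin sin_times_sin p_def q_def left_diff_distrib distrib_right)
  also have "\<dots> = (cos p - cos q) / 4 - cos p * cos (2 * t) / 4 + cos q * cos (2 * t) / 4"
    by (simp add: field_simps)
  also have "\<dots> = (cos p - cos q) / 4 - (cos (p + 2 * t) + cos (p - 2 * t)) / 8 + (cos (q + 2 * t) + cos (q - 2 * t)) / 8"
    unfolding cos_times_cos by (simp add: field_simps)
  finally show ?thesis by (simp add: p_def q_def algebra_simps)
qed

text \<open>Only terms of frequency 0 survive: \<open>m = m'\<close> with weight 1/4, a difference
  of 2 with weight -1/8, and \<open>m + m' = 2\<close>, which adds \<open>l / 8\<close> when both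
  are 1.\<close>

lemma has_integral_profile_mult:
  assumes "l > 0" "m \<ge> 1" "m' \<ge> 1"
  shows "((\<lambda>x. profile m (pi / l * (x - a)) * profile m' (pi / l * (x - a))) has_integral
    (if m = m' then (if m = 1 then 3 * l / 8 else l / 4)
     else if \<bar>int m - int m'\<bar> = 2 then - l / 8 else 0)) {a..a + l}"
proof -
  let ?d = "\<lambda>j::int. if j = 0 then l else 0"
  have "((\<lambda>x. profile m (pi / l * (x - a)) * profile m' (pi / l * (x - a))) has_integral
     (?d (int m - int m') - ?d (int m + int m')) / 4
     - (?d (int m - int m' + 2) + ?d (int m - int m' - 2)) / 8
     + (?d (int m + int m' + 2) + ?d (int m + int m' - 2)) / 8) {a..a + l}"
    unfolding profile_mult
    by (intro has_integral_divide has_integral_diff has_integral_add has_integral_cos assms)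
  also have "(?d (int m - int m') - ?d (int m + int m')) / 4
     - (?d (int m - int m' + 2) + ?d (int m - int m' - 2)) / 8
     + (?d (int m + int m' + 2) + ?d (int m + int m' - 2)) / 8 =
     (if m = m' then (if m = 1 then 3 * l / 8 else l / 4)
     else if \<bar>int m - int m'\<bar> = 2 then - l / 8 else 0)"
    using assms by auto
  finally show ?thesis .
qed

section \<open>The modes before truncation: zeros and derivatives\<close>

definition mode :: "real \<Rightarrow> real \<Rightarrow> real \<Rightarrow> nat \<Rightarrow> nat \<Rightarrow> real \<times> real \<Rightarrow> real" where
  "mode a l c m n z = profile m (pi / l * (fst z - a)) * sin (real n * (pi / c * snd z))"

lemma trig_flat_mode: "trig_flat (mode a l c m n)"
proof -
  have "trig_flat (\<lambda>z. sin ((pi / l, 0) \<bullet> z + (- (pi / l * a))) *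
      sin ((real m * (pi / l), 0) \<bullet> z + (- (real m * (pi / l) * a))) * sin ((0, real n * (pi / c)) \<bullet> z + 0))"
    by (intro trig_flat.intros)
  then show ?thesis
    by (simp add: mode_def[abs_def] profile_def inner_prod_def algebra_simps)
qed

lemma mode_eq_0:
  assumes "l > 0" "c > 0" "z \<in> cbox (a, 0) (a + l, c) - box (a, 0) (a + l, c)"
  shows "mode a l c m n z = 0"
proof -
  obtain x y where z: "z = (x, y)" by (cases z)
  with assms have "x = a \<or> x = a + l \<or> y = 0 \<or> y = c"
    by (auto simp: mem_box_pair)
  with assms show ?thesis
    by (auto simp: mode_def profile_def z)
qed

lemma countable_sin_zeros:
  assumes "k \<noteq> (0::real)"
  shows "countable {x. sin (k * (x - q)) = 0}"
proof (rule countable_subset)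
  show "{x. sin (k * (x - q)) = 0} \<subseteq> range (\<lambda>i::int. of_int i * pi / k + q)"
  proof
    fix x assume "x \<in> {x. sin (k * (x - q)) = 0}"
    then obtain i :: int where "k * (x - q) = of_int i * pi"
      by (auto simp: sin_zero_iff_int2)
    then have "x = of_int i * pi / k + q" using assms by (simp add: field_simps)
    then show "x \<in> range (\<lambda>i::int. of_int i * pi / k + q)" by blast
  qed
qed simp

lemma AE_lborel_pair_notin_countable:
  fixes A B :: "real set"
  assumes "countable A" "countable B"
  shows "AE z in lborel. fst z \<notin> A \<and> snd z \<notin> B"
proof -
  have null: "A \<in> null_sets lborel" "B \<in> null_sets lborel"
    using assms by (auto intro: countable_imp_null_set_lborel)
  then have "A \<times> UNIV \<in> null_sets (lborel \<Otimes>\<^sub>M lborel)" "UNIV \<times> B \<in> null_sets (lborel \<Otimes>\<^sub>M lborel)"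
    using lborel.emeasure_pair_measure_Times[OF null_setsD2[OF null(1)], of UNIV]
      lborel.emeasure_pair_measure_Times[OF _ null_setsD2[OF null(2)], of UNIV lborel]
    by (auto intro!: null_setsI simp: null_setsD1)
  then have "A \<times> UNIV \<union> UNIV \<times> B \<in> null_sets (lborel :: (real \<times> real) measure)"
    by (auto simp: lborel_prod)
  from AE_not_in[OF this] show ?thesis
    by eventually_elim auto
qed

text \<open>The zeros lie on countably many vertical and horizontal lines. \<open>H1_0_box\<close>
  asks for this because its cut-offs recover \<open>P\<close> only off the zeros.\<close>

lemma AE_mode_nonzero:
  assumes "l > 0" "c > 0" "m \<ge> 1" "n \<ge> 1"
  shows "AE z in lborel. mode a l c m n z \<noteq> 0"
proof -
  have "countable ({x. sin (pi / l * (x - a)) = 0} \<union> {x. sin (real m * (pi / l) * (x - a)) = 0})"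
    "countable {y. sin (real n * (pi / c) * (y - 0)) = 0}"
    using assms by (intro countable_Un countable_sin_zeros; simp)+
  from AE_lborel_pair_notin_countable[OF this] show ?thesis
    by eventually_elim (auto simp: mode_def profile_def mult.assoc)
qed

lemma mode_smooth: "smooth (mode a l c m n)"
  by (intro smooth_trig_flat trig_flat_mode)

lemma profile_has_derivative:
  "((\<lambda>t. profile m (k * (t - a)) * Y) has_real_derivative
    k * (cos (k * (x - a)) * sin (real m * (k * (x - a))) +
      real m * sin (k * (x - a)) * cos (real m * (k * (x - a)))) * Y) (at x)"
  unfolding profile_def by (rule derivative_eq_intros refl)+ (auto simp: algebra_simps)

text \<open>The result is split into a multiple of the function itself, to be absorbed by the
  quasi-eigenvalue, and a remainder that grows only linearly in \<open>m\<close>.\<close>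

lemma profile_has_second_derivative:
  "((\<lambda>x. k * (cos (k * (x - a)) * sin (real m * (k * (x - a))) +
      real m * sin (k * (x - a)) * cos (real m * (k * (x - a)))) * Y) has_real_derivative
    k\<^sup>2 * (2 * real m * cos (k * (x - a)) * cos (real m * (k * (x - a))) - profile m (k * (x - a))) * Y
    - (real m)\<^sup>2 * k\<^sup>2 * (profile m (k * (x - a)) * Y)) (at x)"
  unfolding profile_def
  by (rule derivative_eq_intros refl)+ (auto simp: algebra_simps power2_eq_square)

lemma partial_x_mode:
  "partial_x (mode a l c m n) z =
    pi / l * (cos (pi / l * (fst z - a)) * sin (real m * (pi / l * (fst z - a))) +
      real m * sin (pi / l * (fst z - a)) * cos (real m * (pi / l * (fst z - a)))) * sin (real n * (pi / c * snd z))"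
proof -
  obtain x y where z: "z = (x, y)" by (cases z)
  show ?thesis
    unfolding z
    by (rule DERIV_unique[OF partial_x_has_derivative[OF mode_smooth]])
       (simp only: mode_def fst_conv snd_conv profile_has_derivative)
qed

lemma partial_x_partial_x_mode:
  "partial_x (partial_x (mode a l c m n)) z =
    (pi / l)\<^sup>2 * (2 * real m * cos (pi / l * (fst z - a)) * cos (real m * (pi / l * (fst z - a)))
      - profile m (pi / l * (fst z - a))) * sin (real n * (pi / c * snd z))
    - (real m)\<^sup>2 * (pi / l)\<^sup>2 * mode a l c m n z"
proof -
  obtain x y where z: "z = (x, y)" by (cases z)
  show ?thesis
    unfolding z
    by (rule DERIV_unique[OF partial_x_has_derivative[OF smooth_partial_x[OF mode_smooth]]])
       (simp only: partial_x_mode mode_def fst_conv snd_conv profile_has_second_derivative)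
qed

lemma sin_mult_has_derivative: "((\<lambda>t. sin (n * (k * t))) has_real_derivative n * k * cos (n * (k * t))) (at t)"
  and cos_mult_has_derivative: "((\<lambda>t. cos (n * (k * t))) has_real_derivative - (n * k * sin (n * (k * t)))) (at t)"
  for n k t :: real
  by (auto intro!: derivative_eq_intros)

lemma partial_y_mode:
  "partial_y (mode a l c m n) z =
    real n * (pi / c) * profile m (pi / l * (fst z - a)) * cos (real n * (pi / c * snd z))"
proof -
  obtain x y where z: "z = (x, y)" by (cases z)
  show ?thesis
    unfolding z
    using DERIV_cmult[OF sin_mult_has_derivative, of "profile m (pi / l * (x - a))" "real n" "pi / c" y]
    by (intro DERIV_unique[OF partial_y_has_derivative[OF mode_smooth]]) (simp add: mode_def mult_ac)
qed

lemma partial_y_partial_y_mode: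
  "partial_y (partial_y (mode a l c m n)) z = - (real n)\<^sup>2 * (pi / c)\<^sup>2 * mode a l c m n z"
proof -
  obtain x y where z: "z = (x, y)" by (cases z)
  show ?thesis
    unfolding z
    using DERIV_cmult[OF cos_mult_has_derivative, of "real n * (pi / c) * profile m (pi / l * (x - a))" "real n" "pi / c" y]
    by (intro DERIV_unique[OF partial_y_has_derivative[OF smooth_partial_y[OF mode_smooth]]])
       (simp add: partial_y_mode mode_def power2_eq_square mult_ac)
qed

text \<open>The quasi-eigenvalue cancels all terms quadratic in \<open>m\<close> or
  \<open>n\<close>. What remains is the cross term of the product rule and the term in which the
  factor \<open>sin t\<close> is differentiated twice.\<close>

lemma laplacian_mode:
  "laplacian (mode a l c m n) z + ((real n)\<^sup>2 * (pi / c)\<^sup>2 + (real m)\<^sup>2 * (pi / l)\<^sup>2) * mode a l c m n z =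
    (pi / l)\<^sup>2 * (2 * real m * cos (pi / l * (fst z - a)) * cos (real m * (pi / l * (fst z - a)))
      - profile m (pi / l * (fst z - a))) * sin (real n * (pi / c * snd z))"
  unfolding laplacian_def partial_x_partial_x_mode partial_y_partial_y_mode by (simp add: algebra_simps)

lemma integral_cbox_mult:
  fixes f g :: "real \<Rightarrow> real"
  assumes "continuous_on UNIV f" "continuous_on UNIV g"
  shows "integral (cbox (a, c) (b, d)) (\<lambda>z. f (fst z) * g (snd z)) = integral {a..b} f * integral {c..d} g"
proof -
  have "continuous_on (cbox (a, c) (b, d)) (\<lambda>z. f (fst z) * g (snd z))"
    by (intro continuous_on_mult continuous_on_compose2[OF assms(1)] continuous_on_compose2[OF assms(2)]
        continuous_intros) auto
  from integral_prod_continuous[OF this] show ?thesis by simp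
qed

section \<open>Inner products, norms and discrepancy of the truncated modes\<close>

definition strip_mode :: "real \<Rightarrow> real \<Rightarrow> real \<Rightarrow> nat \<Rightarrow> nat \<Rightarrow> real \<times> real \<Rightarrow> real" where
  "strip_mode a l c m n z = indicator (box (a, 0) (a + l, c)) z * mode a l c m n z"

lemma L2_inner_strip_mode:
  assumes "box (a, 0) (a + l, c) \<subseteq> D" "l > 0" "c > 0" "m \<ge> 1" "m' \<ge> 1" "n \<ge> 1" "n' \<ge> 1"
  shows "L2_inner D (strip_mode a l c m n) (strip_mode a l c m' n') =
    (if m = m' then (if m = 1 then 3 * l / 8 else l / 4)
     else if \<bar>int m - int m'\<bar> = 2 then - l / 8 else 0) * (if n = n' then c / 2 else 0)"
proof -
  have "L2_inner D (strip_mode a l c m n) (strip_mode a l c m' n') =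
      integral (cbox (a, 0) (a + l, c)) (\<lambda>z. mode a l c m n z * mode a l c m' n' z)"
    unfolding strip_mode_def[abs_def]
    by (intro L2_inner_indicator2 assms(1) smooth_continuous_on mode_smooth)
  also have "(\<lambda>z. mode a l c m n z * mode a l c m' n' z) =
      (\<lambda>z. (profile m (pi / l * (fst z - a)) * profile m' (pi / l * (fst z - a))) *
         (sin (real n * (pi / c * (snd z - 0))) * sin (real n' * (pi / c * (snd z - 0)))))"
    by (simp add: mode_def mult_ac)
  also have "integral (cbox (a, 0) (a + l, c)) \<dots> =
      integral {a..a + l} (\<lambda>x. profile m (pi / l * (x - a)) * profile m' (pi / l * (x - a))) *
      integral {0..0 + c} (\<lambda>y. sin (real n * (pi / c * (y - 0))) * sin (real n' * (pi / c * (y - 0))))"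
    by (subst integral_cbox_mult) (use assms in \<open>auto simp: profile_def intro!: continuous_intros\<close>)
  finally show ?thesis
    unfolding integral_unique[OF has_integral_profile_mult[OF assms(2,4,5)]]
      integral_unique[OF has_integral_sin_sin[OF assms(3,6,7)]] .
qed

text \<open>The squared norm is \<open>3 * l * c / 16\<close> for \<open>m = 1\<close> and
  \<open>l * c / 8\<close> otherwise, so the lower bound is attained for
  \<open>m \<ge> 2\<close>.\<close>

lemma L2_norm_strip_mode:
  assumes "box (a, 0) (a + l, c) \<subseteq> D" "l > 0" "c > 0" "m \<ge> 1" "n \<ge> 1"
  shows "L2_norm D (strip_mode a l c m n) > 0"
    and "L2_norm D (strip_mode a l c m n) \<ge> sqrt (l * c / 8)"
  using assms by (auto simp: L2_norm_eq_sqrt_inner L2_inner_strip_mode)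

text \<open>Overlap occurs only when the indices differ by 2. Then the inner product has size
  \<open>l * c / 16\<close>, the norms multiply to at least \<open>l * c / 8\<close>, the minimum is
  0.001, and the factor 1000 cancels it.\<close>

lemma strip_mode_quasi_orthogonal:
  assumes "box (a, 0) (a + l, c) \<subseteq> D" "l > 0" "c > 0" "m \<ge> 1" "m' \<ge> 1" "n \<ge> 1" "m \<noteq> m'"
  shows "\<bar>L2_inner D (strip_mode a l c m n) (strip_mode a l c m' n)\<bar> \<le>
    1000 * (min 0.001 (1 / \<bar>real m - real m'\<bar>) *
      L2_norm D (strip_mode a l c m n) * L2_norm D (strip_mode a l c m' n))"
proof (cases "\<bar>int m - int m'\<bar> = 2")
  case True
  then have d: "\<bar>real m - real m'\<bar> = 2" by linarith
  have "sqrt (l * c / 8) * sqrt (l * c / 8) \<le>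
      L2_norm D (strip_mode a l c m n) * L2_norm D (strip_mode a l c m' n)"
    using assms by (intro mult_mono L2_norm_strip_mode) (auto simp: L2_norm_eq_sqrt_inner L2_inner_strip_mode)
  then have "l * c / 8 \<le> L2_norm D (strip_mode a l c m n) * L2_norm D (strip_mode a l c m' n)"
    using assms by simp
  moreover have "\<bar>L2_inner D (strip_mode a l c m n) (strip_mode a l c m' n)\<bar> = l * c / 16"
    using assms True by (simp add: L2_inner_strip_mode abs_mult)
  moreover have "l * c > 0" using assms by simp
  ultimately show ?thesis unfolding d by simp
next
  case False
  then show ?thesis
    using assms by (simp add: L2_inner_strip_mode L2_norm_eq_sqrt_inner)
qed

text \<open>The remainder is at most \<open>3 * real m * (pi / l)\<^sup>2\<close> times the sine in
  \<open>y\<close>. The square of that sine integrates to \<open>c / 2\<close>, and 9/2 = 36/8, so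
  the constant is 6 relative to the lower bound \<open>sqrt (l * c / 8)\<close> of the norm.\<close>

lemma strip_mode_quasimode:
  assumes "open D" "box (a, 0) (a + l, c) \<subseteq> D" "l > 0" "c > 0" "m \<ge> 1" "n \<ge> 1"
    and bdry: "\<And>x. x \<in> {a..a + l} \<Longrightarrow> (x, 0) \<notin> D" "\<And>x. x \<in> {a..a + l} \<Longrightarrow> (x, c) \<notin> D"
  shows "quasimode D (strip_mode a l c m n) ((real n)\<^sup>2 * (pi / c)\<^sup>2 + (real m)\<^sup>2 * (pi / l)\<^sup>2)
    (6 * (real m * (pi / l)\<^sup>2))"
proof -
  let ?R = "box (a, 0) (a + l, c)"
  let ?\<mu> = "(real n)\<^sup>2 * (pi / c)\<^sup>2 + (real m)\<^sup>2 * (pi / l)\<^sup>2"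
  define w where "w z = indicator ?R z * laplacian (mode a l c m n) z" for z
  define r where "r z = (pi / l)\<^sup>2 * (2 * real m * cos (pi / l * (fst z - a)) * cos (real m * (pi / l * (fst z - a)))
      - profile m (pi / l * (fst z - a))) * sin (real n * (pi / c * snd z))" for z
  have H: "strip_mode a l c m n \<in> H1_0 D"
    unfolding strip_mode_def[abs_def]
    by (rule H1_0_box[OF _ _ assms(2,1) trig_flat_mode mode_eq_0 AE_mode_nonzero]) (use assms in auto)
  have L: "weak_laplacian D (strip_mode a l c m n) w"
    unfolding strip_mode_def[abs_def] w_def[abs_def]
    by (rule weak_laplacian_box[OF _ _ assms(2) _ mode_smooth mode_eq_0])
       (use assms in \<open>auto simp: partial_x_mode\<close>)
  have cont_r: "continuous_on UNIV r"
    unfolding r_def[abs_def] profile_def by (intro continuous_intros)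
  have "L2_norm D (\<lambda>z. w z + ?\<mu> * strip_mode a l c m n z) = L2_norm D (\<lambda>z. indicator ?R z * r z)"
    unfolding w_def strip_mode_def r_def laplacian_mode[symmetric] by (simp add: algebra_simps)
  also have "\<dots> = sqrt (integral (cbox (a, 0) (a + l, c)) (\<lambda>z. (r z)\<^sup>2))"
    by (rule L2_norm_indicator[OF assms(2) cont_r])
  also have "integral (cbox (a, 0) (a + l, c)) (\<lambda>z. (r z)\<^sup>2) \<le>
      integral (cbox (a, 0) (a + l, c)) (\<lambda>z. (3 * real m * (pi / l)\<^sup>2)\<^sup>2 * (sin (real n * (pi / c * snd z)))\<^sup>2)"
  proof (rule integral_le)
    fix z :: "real \<times> real"
    define X where "X = 2 * real m * cos (pi / l * (fst z - a)) * cos (real m * (pi / l * (fst z - a)))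
      - profile m (pi / l * (fst z - a))"
    have "\<bar>cos (pi / l * (fst z - a)) * cos (real m * (pi / l * (fst z - a)))\<bar> \<le> 1 * 1"
      unfolding abs_mult by (intro mult_mono) auto
    then have "real m * \<bar>cos (pi / l * (fst z - a)) * cos (real m * (pi / l * (fst z - a)))\<bar> \<le> real m * 1"
      by (intro mult_left_mono) auto
    moreover have "\<bar>profile m (pi / l * (fst z - a))\<bar> \<le> 1 * 1"
      unfolding abs_mult profile_def by (intro mult_mono) auto
    moreover have "\<bar>X\<bar> \<le> 2 * (real m * \<bar>cos (pi / l * (fst z - a)) * cos (real m * (pi / l * (fst z - a)))\<bar>)
        + \<bar>profile m (pi / l * (fst z - a))\<bar>"
      unfolding X_def by (rule order_trans[OF abs_triangle_ineq4]) (simp add: abs_mult)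
    \<comment> \<open>Since \<open>m \<ge> 1\<close>, the bound 1 on the profile is absorbed: 2m + 1
      is at most 3m.\<close>
    ultimately have "\<bar>X\<bar> \<le> 3 * real m" using assms(5) by linarith
    then have "X\<^sup>2 \<le> (3 * real m)\<^sup>2" by (metis abs_ge_zero power2_abs power_mono)
    then have "X\<^sup>2 * (((pi / l)\<^sup>2)\<^sup>2 * (sin (real n * (pi / c * snd z)))\<^sup>2) \<le>
        (3 * real m)\<^sup>2 * (((pi / l)\<^sup>2)\<^sup>2 * (sin (real n * (pi / c * snd z)))\<^sup>2)"
      by (rule mult_right_mono) simp
    then show "(r z)\<^sup>2 \<le> (3 * real m * (pi / l)\<^sup>2)\<^sup>2 * (sin (real n * (pi / c * snd z)))\<^sup>2"
      by (simp add: r_def X_def power_mult_distrib mult_ac)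
  qed (intro integrable_on_cbox continuous_intros cont_r)+
  also have "integral (cbox (a, 0) (a + l, c)) (\<lambda>z. (3 * real m * (pi / l)\<^sup>2)\<^sup>2 * (sin (real n * (pi / c * snd z)))\<^sup>2) =
      integral {a..a + l} (\<lambda>x. (3 * real m * (pi / l)\<^sup>2)\<^sup>2) *
      integral {0..0 + c} (\<lambda>y. sin (real n * (pi / c * (y - 0))) * sin (real n * (pi / c * (y - 0))))"
    unfolding power2_eq_square[of "sin _"]
    by (subst integral_cbox_mult[symmetric]) (use assms in \<open>auto intro!: continuous_intros simp: mult.assoc\<close>)
  also have "\<dots> = (6 * (real m * (pi / l)\<^sup>2))\<^sup>2 * (l * c / 8)"
    unfolding integral_unique[OF has_integral_sin_sin[OF assms(4,6,6)]]
    using assms by (simp add: power_mult_distrib)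
  also have "sqrt \<dots> = 6 * (real m * (pi / l)\<^sup>2) * sqrt (l * c / 8)"
    unfolding real_sqrt_mult[of "_\<^sup>2"] real_sqrt_abs by simp
  also have "\<dots> \<le> 6 * (real m * (pi / l)\<^sup>2) * L2_norm D (strip_mode a l c m n)"
    by (intro mult_left_mono L2_norm_strip_mode) (use assms in auto)
  finally have "L2_norm D (\<lambda>z. w z + ?\<mu> * strip_mode a l c m n z) \<le>
      6 * (real m * (pi / l)\<^sup>2) * L2_norm D (strip_mode a l c m n)"
    by simp
  then show ?thesis
    unfolding quasimode_def using H L L2_norm_strip_mode(1)[OF assms(2-6)] by auto
qed

subsection \<open>Staircase domains\<close>

text \<open>Step \<open>j\<close> has length \<open>L j\<close> and a height fixed by the spectral
  level \<open>v j\<close>. Divergence of the lengths makes the steps cover the half-line. Length 0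
  is allowed so that idle filler steps can stay in the sequence; a positive first length serves
  connectedness.\<close>

locale staircase =
  fixes v L :: "nat \<Rightarrow> real"
  assumes v_pos: "\<And>j. 0 < v j" and v_mono: "mono v" and v_lim: "filterlim v at_top sequentially"
    and L_nonneg: "\<And>j. 0 \<le> L j" and L_0: "0 < L 0" and L_div: "\<not> summable L"
begin

definition pos :: "nat \<Rightarrow> real" where "pos j = (\<Sum>i<j. L i)"

text \<open>The steps are half-open intervals containing their left ends, and the least index skips
  empty ones.\<close>

definition idx :: "real \<Rightarrow> nat" where "idx x = (LEAST j. x < pos (Suc j))"

text \<open>This makes \<open>v j\<close> the lowest Dirichlet eigenvalue of the vertical
  cross-section of step \<open>j\<close>.\<close>

definition height :: "nat \<Rightarrow> real" where "height j = pi / sqrt (v j)"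

definition stairs :: "real \<Rightarrow> real" where "stairs x = height (idx x)"

lemma pos_0 [simp]: "pos 0 = 0" and pos_Suc: "pos (Suc j) = pos j + L j"
  by (simp_all add: pos_def)

lemma pos_mono: "i \<le> j \<Longrightarrow> pos i \<le> pos j"
  by (auto simp: pos_def L_nonneg intro!: sum_mono2)

lemma pos_nonneg: "0 \<le> pos j"
  using pos_mono[of 0 j] by simp

lemma pos_unbounded: "\<exists>j. x < pos j"
proof (rule ccontr)
  assume "\<nexists>j. x < pos j"
  then have "sum L {..<j} \<le> x" for j by (simp add: pos_def not_less)
  then show False using summableI_nonneg_bounded[of L x] L_nonneg L_div by blast
qed

lemma idx_le_iff: "idx x \<le> j \<longleftrightarrow> x < pos (Suc j)"
proof
  assume "idx x \<le> j"
  \<comment> \<open>Unboundedness of the positions ensures that the set whose least element defines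
    \<open>idx x\<close> is not empty.\<close>
  obtain i where "x < pos i" using pos_unbounded by blast
  then have "x < pos (Suc i)" using pos_mono[of i "Suc i"] by simp
  then have "x < pos (Suc (idx x))" unfolding idx_def by (rule LeastI)
  also have "\<dots> \<le> pos (Suc j)" using \<open>idx x \<le> j\<close> by (intro pos_mono) simp
  finally show "x < pos (Suc j)" .
qed (simp add: idx_def Least_le)

lemma le_idx_iff:
  assumes "0 \<le> x"
  shows "j \<le> idx x \<longleftrightarrow> pos j \<le> x"
proof (cases j)
  case (Suc k)
  then show ?thesis using idx_le_iff[of x k] by auto
qed (use assms in simp)

lemma idx_eq: "pos j \<le> x \<Longrightarrow> x < pos (Suc j) \<Longrightarrow> idx x = j"
  using idx_le_iff le_idx_iff pos_nonneg by (meson order.antisym order.trans)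

lemma idx_mono: "x \<le> y \<Longrightarrow> idx x \<le> idx y"
  by (meson idx_le_iff order.refl order.strict_trans1)

lemma height_pos: "0 < height j"
  using v_pos by (simp add: height_def)

lemma height_antimono: "i \<le> j \<Longrightarrow> height j \<le> height i"
  using v_pos monoD[OF v_mono, of i j] by (auto simp: height_def intro!: divide_left_mono)

lemma pi_over_height: "(pi / height j)\<^sup>2 = v j" "pi\<^sup>2 / (height j)\<^sup>2 = v j"
  using v_pos[of j] by (simp_all add: height_def power_divide)

lemma stairs_pos: "0 < stairs x"
  by (simp add: stairs_def height_pos)

lemma stairs_antimono: "x \<le> y \<Longrightarrow> stairs y \<le> stairs x"
  by (simp add: stairs_def height_antimono idx_mono)

lemma stairs_right_continuous:
  assumes "0 \<le> x"
  shows "continuous (at_right x) stairs"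
  unfolding continuous_within
proof (rule tendsto_eventually)
  have "x < pos (Suc (idx x))" by (simp add: idx_le_iff[symmetric])
  then have "eventually (\<lambda>y. x < y \<and> y < pos (Suc (idx x))) (at_right x)"
    by (simp add: eventually_at_right_field) blast
  then show "eventually (\<lambda>y. stairs y = stairs x) (at_right x)"
  proof eventually_elim
    case (elim y)
    then have "pos (idx x) \<le> y" using le_idx_iff[OF assms, of "idx x"] by simp
    with elim show ?case using idx_eq unfolding stairs_def by metis
  qed
qed

lemma stairs_tendsto_0: "(stairs \<longlongrightarrow> 0) at_top"
proof -
  have "filterlim idx sequentially at_top"
    unfolding filterlim_at_top
  proof
    fix Z
    show "eventually (\<lambda>x. Z \<le> idx x) at_top"
      using eventually_ge_at_top[of "max 0 (pos Z)"] by eventually_elim (simp add: le_idx_iff)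
  qed
  moreover have "height \<longlonglongrightarrow> 0"
    unfolding height_def[abs_def]
    by (intro tendsto_divide_0[OF tendsto_const] filterlim_at_top_imp_at_infinity
        filterlim_compose[OF sqrt_at_top v_lim])
  ultimately show ?thesis
    unfolding stairs_def[abs_def] by (rule filterlim_compose[rotated])
qed

text \<open>The function is a series of multiples of indicators of the steps, at most one of them
  nonzero at each point. The terms integrate to \<open>L j * g j\<close>, so the series may be
  integrated termwise.\<close>

lemma set_integrable_stairs:
  assumes "\<And>j. 0 \<le> g j" "summable (\<lambda>j. L j * g j)"
  shows "set_integrable lborel {0..} (\<lambda>x. g (idx x))"
proof -
  let ?f = "\<lambda>j x. g j * indicator {pos j..<pos (Suc j)} x"
  have f: "?f j x = (if j = idx x then indicator {0..} x * g j else 0)" for j x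
  proof (cases "x \<ge> 0")
    case True
    then have "x \<in> {pos j..<pos (Suc j)} \<longleftrightarrow> j = idx x"
      using le_idx_iff[OF True, of j] idx_le_iff[of x j] by auto
    with True show ?thesis by (simp add: indicator_def)
  next
    case False
    with pos_nonneg[of j] have "x \<notin> {pos j..<pos (Suc j)}" by auto
    with False show ?thesis by (simp only: indicator_def) simp
  qed
  have "(\<lambda>j. ?f j x) sums (indicator {0..} x * g (idx x))" for x
    unfolding f by (rule sums_single)
  then have "(\<lambda>x. \<Sum>j. ?f j x) = (\<lambda>x. indicator {0..} x * g (idx x))"
    by (simp add: sums_iff)
  moreover have "integrable lborel (\<lambda>x. \<Sum>j. ?f j x)"
  proof (rule integrable_suminf)
    show "integrable lborel (?f j)" for j
      by (intro integrable_mult_right) (simp add: integrable_indicator_iff pos_Suc L_nonneg)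
    have "summable (\<lambda>j. norm (?f j x))" for x
      by (rule summable_finite[of "{idx x}"]) (auto simp: f)
    then show "AE x in lborel. summable (\<lambda>j. norm (?f j x))" by simp
    have "(LINT x|lborel. norm (?f j x)) = L j * g j" for j
      using assms(1)[of j] L_nonneg[of j] by (simp add: pos_Suc abs_mult)
    then show "summable (\<lambda>j. LINT x|lborel. norm (?f j x))"
      using assms(2) by simp
  qed
  ultimately show ?thesis by (simp add: set_integrable_def)
qed

section \<open>Topology of the horn and position of its strips\<close>

abbreviation horn where "horn \<equiv> horn_domain stairs"

text \<open>Decreasing heights let each strip be prolonged leftwards to \<open>x = 0\<close> within
  the horn. This shows the horn as a union of open boxes in spite of the jumps of the
  profile.\<close>

lemma horn_domain_stairs: "horn = (\<Union>j. box (0, 0) (pos (Suc j), height j))"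
proof (intro equalityI subsetI)
  fix z assume "z \<in> horn"
  then show "z \<in> (\<Union>j. box (0, 0) (pos (Suc j), height j))"
    by (cases z) (auto simp: horn_domain_def stairs_def mem_box_pair idx_le_iff[symmetric])
next
  fix z assume "z \<in> (\<Union>j. box (0, 0) (pos (Suc j), height j))"
  then obtain j x y where "z = (x, y)" "0 < x" "idx x \<le> j" "0 < y" "y < height j"
    by (cases z) (auto simp: mem_box_pair idx_le_iff)
  with height_antimono[of "idx x" j] show "z \<in> horn"
    by (simp add: horn_domain_def stairs_def)
qed

lemma open_horn: "open horn"
  unfolding horn_domain_stairs by (intro open_UN ballI open_box)

text \<open>Every box shares the point \<open>(L 0 / 2, height j / 2)\<close> with the first
  one.\<close>

lemma connected_horn: "connected horn"
proof -
  let ?B = "\<lambda>j. box (0, 0) (pos (Suc j), height j)"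
  have "connected (\<Union>j. ?B 0 \<union> ?B j)"
  proof (rule connected_Union)
    have common: "(L 0 / 2, height j / 2) \<in> ?B 0 \<inter> ?B j" for j
      using L_0 height_pos[of j] height_antimono[of 0 j] pos_mono[of "Suc 0" "Suc j"]
      by (auto simp: mem_box_pair pos_Suc)
    have "connected (?B 0 \<union> ?B j)" for j
      by (intro connected_Un convex_connected convex_box) (use common[of j] in blast)
    then show "connected s" if "s \<in> range (\<lambda>j. ?B 0 \<union> ?B j)" for s
      using that by blast
    show "\<Inter> (range (\<lambda>j. ?B 0 \<union> ?B j)) \<noteq> {}"
      using common by blast
  qed
  also have "(\<Union>j. ?B 0 \<union> ?B j) = horn"
    unfolding horn_domain_stairs by blast
  finally show ?thesis .
qed

lemma strip_subset: "box (pos j, 0) (pos j + L j, height j) \<subseteq> horn"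
proof
  fix z assume "z \<in> box (pos j, 0) (pos j + L j, height j)"
  with pos_nonneg[of j] have "z \<in> box (0, 0) (pos (Suc j), height j)"
    by (cases z) (auto simp: mem_box_pair pos_Suc)
  then show "z \<in> horn" unfolding horn_domain_stairs by blast
qed

lemma strip_boundary:
  assumes "x \<in> {pos j..pos j + L j}"
  shows "(x, 0) \<notin> horn" "(x, height j) \<notin> horn"
proof -
  \<comment> \<open>The right end already belongs to a later step, so only an inequality is
    available; decreasing heights make it enough.\<close>
  have "j \<le> idx x" using assms pos_nonneg[of j] by (subst le_idx_iff) auto
  from height_antimono[OF this] show "(x, height j) \<notin> horn"
    by (simp add: horn_domain_def stairs_def)
qed (simp add: horn_domain_def)

definition stair_mode :: "nat \<Rightarrow> nat \<Rightarrow> nat \<Rightarrow> real \<times> real \<Rightarrow> real" where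
  "stair_mode j = strip_mode (pos j) (L j) (height j)"

lemma L2_inner_stair_mode_eq_0:
  assumes "j \<noteq> j'"
  shows "L2_inner horn (stair_mode j m n) (stair_mode j' m' n') = 0"
proof -
  have *: "box (pos j, 0) (pos j + L j, height j) \<inter> box (pos j', 0) (pos j' + L j', height j') = {}"
    if "j < j'" for j j'
    using pos_mono[of "Suc j" j'] that by (auto simp: mem_box_pair pos_Suc)
  have "box (pos j, 0) (pos j + L j, height j) \<inter> box (pos j', 0) (pos j' + L j', height j') = {}"
    using assms *[of j j'] *[of j' j] by (cases "j < j'") auto
  then have "stair_mode j m n z * stair_mode j' m' n' z = 0" for z
    unfolding stair_mode_def strip_mode_def by (auto simp: indicator_def)
  then show ?thesis by (simp only: L2_inner_def set_lebesgue_integral_def) simp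
qed

text \<open>From some step on, the strips lie to the right of \<open>K\<close>. The threshold
  depends on \<open>K\<close> alone, which gives uniformity in \<open>m\<close> and
  \<open>n\<close>, and the norms agree exactly.\<close>

lemma L2_norm_stair_mode_escapes:
  assumes "compact K"
  shows "\<exists>J. \<forall>j\<ge>J. \<forall>m n. L2_norm (horn - K) (stair_mode j m n) = L2_norm horn (stair_mode j m n)"
proof -
  obtain B where B: "\<And>z. z \<in> K \<Longrightarrow> norm z \<le> B"
    using compact_imp_bounded[OF assms] by (auto simp: bounded_iff)
  obtain J where J: "B < pos J" using pos_unbounded by blast
  have "L2_norm (horn - K) (stair_mode j m n) = L2_norm horn (stair_mode j m n)" if "j \<ge> J" for j m n
  proof -
    have "stair_mode j m n z = 0" if "z \<in> K" for z
    proof -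
      obtain x y where z: "z = (x, y)" by (cases z)
      have "x \<le> norm z" using norm_fst_le[of x y] by (simp add: z)
      also have "\<dots> \<le> B" using that by (rule B)
      also have "B < pos j" using J pos_mono[OF \<open>j \<ge> J\<close>] by simp
      finally show ?thesis
        by (simp add: stair_mode_def strip_mode_def z mem_box_pair)
    qed
    then show ?thesis
      unfolding L2_norm_def set_lebesgue_integral_def
      by (intro arg_cong[where f = sqrt] Bochner_Integration.integral_cong) (auto simp: indicator_def)
  qed
  then show ?thesis by blast
qed

end

section \<open>Filler strips of summable cost\<close>

text \<open>Since \<open>h\<close> is not in \<open>\<Omega>(sqrt)\<close>, there are arbitrarily
  large levels with \<open>h x / sqrt x\<close> as small as desired. Unit lengths at infinitely many
  of them diverge, while the k-th costs at most \<open>(1 / 2) ^ k\<close>. The bounds by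
  consecutive terms of \<open>M\<close> let the fillers be interleaved monotonically.\<close>

lemma filler_sequence:
  fixes h :: "real \<Rightarrow> real" and M :: "nat \<Rightarrow> real"
  assumes h_nonneg: "\<And>x. 0 \<le> x \<Longrightarrow> 0 \<le> h x" and h_sqrt: "h \<notin> \<Omega>(sqrt)"
    and M_pos: "0 < M 0" and M_mono: "mono M" and M_lim: "filterlim M at_top sequentially"
  obtains \<nu> \<kappa> :: "nat \<Rightarrow> real" where "\<And>i. M i \<le> \<nu> i" "\<And>i. \<nu> i \<le> M (Suc i)" "\<And>i. 0 \<le> \<kappa> i"
    "\<not> summable \<kappa>" "summable (\<lambda>i. \<kappa> i * ((1 + h (\<nu> i)) / sqrt (\<nu> i)))"
proof -
  have M_gt_0: "0 < M i" for i using M_pos monoD[OF M_mono, of 0 i] by simp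
  have ex: "\<exists>i x. I < i \<and> M i \<le> x \<and> x \<le> M (Suc i) \<and> (1 + h x) / sqrt x \<le> e" if "e > 0" for e I
  proof -
    \<comment> \<open>The first bound pushes \<open>x\<close> past index \<open>I\<close>; the
      second makes \<open>1 / sqrt x\<close> at most \<open>e / 2\<close>, which leaves the other
      half for \<open>h x / sqrt x\<close>.\<close>
    define N where "N = max (M (Suc I)) ((2 / e)\<^sup>2)"
    from h_sqrt have "\<not> eventually (\<lambda>x. norm (h x) \<ge> e / 2 * norm (sqrt x)) at_top"
      using \<open>e > 0\<close> unfolding bigomega_def mem_Collect_eq by (metis half_gt_zero)
    then obtain x where x: "x \<ge> N" "\<bar>h x\<bar> < e / 2 * \<bar>sqrt x\<bar>"
      by (auto simp: eventually_at_top_linorder not_le)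
    have x_pos: "x > 0" using x(1) M_gt_0[of "Suc I"] by (simp add: N_def)
    have "2 / e \<le> sqrt x" using x(1) by (intro real_le_rsqrt) (simp add: N_def)
    then have "1 \<le> e / 2 * sqrt x" using \<open>e > 0\<close> by (simp add: field_simps)
    moreover have "h x < e / 2 * sqrt x" using x(2) x_pos by simp
    ultimately have q: "(1 + h x) / sqrt x \<le> e" using x_pos by (simp add: divide_le_eq)
    have "\<exists>j. x < M j"
      using M_lim by (auto simp: filterlim_at_top_dense eventually_sequentially)
    \<comment> \<open>The least such index brackets \<open>x\<close> between consecutive terms of
      \<open>M\<close>.\<close>
    define j where "j = (LEAST j. x < M j)"
    have j: "x < M j" unfolding j_def using \<open>\<exists>j. x < M j\<close> by (rule LeastI_ex)
    have "M (Suc I) \<le> x" using x(1) by (simp add: N_def)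
    with j have "Suc I < j" using monoD[OF M_mono, of j "Suc I"] by (meson not_less order.strict_trans1 order.trans)
    then obtain i where i: "j = Suc i" "I < i" by (cases j) auto
    have "M i \<le> x" using not_less_Least[of i "\<lambda>j. x < M j"] i(1) by (simp add: j_def[symmetric])
    with i j q show ?thesis by (intro exI[of _ i] exI[of _ x]) auto
  qed
  define P where "P k p \<longleftrightarrow> M (fst p) \<le> snd p \<and> snd p \<le> M (Suc (fst p)) \<and>
    (1 + h (snd p)) / sqrt (snd p) \<le> (1 / 2) ^ k" for k :: nat and p :: "nat \<times> real"
  \<comment> \<open>Strictly increasing indices put at most one filler between consecutive terms of
    \<open>M\<close>.\<close>
  have "\<exists>f. \<forall>k. P k (f k) \<and> fst (f k) < fst (f (Suc k))"
  proof (rule dependent_nat_choice)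
    show "\<exists>p. P 0 p" using ex[of 1 0] by (auto simp: P_def)
    show "\<exists>p'. P (Suc k) p' \<and> fst p < fst p'" for p k
      using ex[of "(1 / 2) ^ Suc k" "fst p"] by (auto simp: P_def)
  qed
  then obtain f where f: "\<And>k. P k (f k)" "\<And>k. fst (f k) < fst (f (Suc k))" by blast
  define r where "r k = fst (f k)" for k
  have r: "strict_mono r" using f(2) by (simp add: strict_mono_Suc_iff r_def)
  have inv_r: "inv r (r k) = k" for k by (simp add: strict_mono_imp_inj_on[OF r] inv_f_f)
  \<comment> \<open>At indices that are not selected, \<open>M i\<close> is a placeholder satisfying
    both bounds; the length \<open>\<kappa> i\<close> is 0 there.\<close>
  define \<nu> where "\<nu> i = (if i \<in> range r then snd (f (inv r i)) else M i)" for i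
  define \<kappa> :: "nat \<Rightarrow> real" where "\<kappa> = indicator (range r)"
  show thesis
  proof
    have "M (r k) \<le> snd (f k) \<and> snd (f k) \<le> M (Suc (r k))" for k
      using f(1) by (simp add: P_def r_def)
    then show "M i \<le> \<nu> i" "\<nu> i \<le> M (Suc i)" for i
      using monoD[OF M_mono, of i "Suc i"] by (auto simp: \<nu>_def inv_r)
    show "0 \<le> \<kappa> i" for i by (simp add: \<kappa>_def)
    show "\<not> summable \<kappa>"
    proof
      assume "summable \<kappa>"
      then have "(\<lambda>k. \<kappa> (r k)) \<longlonglongrightarrow> 0"
        using LIMSEQ_subseq_LIMSEQ[OF summable_LIMSEQ_zero r] by (simp add: o_def)
      then show False by (simp add: \<kappa>_def LIMSEQ_const_iff)
    qed
    have "summable (\<lambda>k. \<kappa> (r k) * ((1 + h (\<nu> (r k))) / sqrt (\<nu> (r k))))"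
    proof (rule summable_comparison_test'[OF summable_geometric[of "1 / 2"]])
      fix k
      have "snd (f k) > 0" using f(1)[of k] M_gt_0[of "fst (f k)"] by (simp add: P_def)
      with h_nonneg[of "snd (f k)"] f(1)[of k]
      show "norm (\<kappa> (r k) * ((1 + h (\<nu> (r k))) / sqrt (\<nu> (r k)))) \<le> (1 / 2) ^ k"
        by (simp add: \<kappa>_def \<nu>_def inv_r P_def)
    qed simp
    then show "summable (\<lambda>i. \<kappa> i * ((1 + h (\<nu> i)) / sqrt (\<nu> i)))"
      by (subst (asm) summable_mono_reindex[OF r]) (auto simp: \<kappa>_def)
  qed
qed

lemma summable_even_odd:
  fixes t :: "nat \<Rightarrow> real"
  assumes "\<And>j. 0 \<le> t j" "summable (\<lambda>i. t (2 * i))" "summable (\<lambda>i. t (Suc (2 * i)))"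
  shows "summable t"
proof (rule summableI_nonneg_bounded)
  show "0 \<le> t j" for j by fact
  fix n
  have "sum t {..<n} \<le> sum t {..<2 * n}"
    using assms(1) by (intro sum_mono2) auto
  also have "\<dots> = (\<Sum>i<n. t (2 * i)) + (\<Sum>i<n. t (Suc (2 * i)))"
    by (induction n) auto
  also have "\<dots> \<le> (\<Sum>i. t (2 * i)) + (\<Sum>i. t (Suc (2 * i)))"
    using assms by (intro add_mono sum_le_suminf) auto
  finally show "sum t {..<n} \<le> (\<Sum>i. t (2 * i)) + (\<Sum>i. t (Suc (2 * i)))" .
qed

section \<open>Construction of the domain and its quasimodes\<close>

text \<open>\<open>h_sqrt\<close> excludes the case in which, by
  \<open>weighted_area_imp_not_bigomega_sqrt\<close>, no profile has finite weighted area, and it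
  supplies the fillers. \<open>h_\<mu>_pos\<close> allows the division by \<open>h (\<mu> i)\<close>
  in the strip lengths.\<close>

theorem theorem1:
  fixes h \<tau> :: "real \<Rightarrow> real" and \<mu> :: "nat \<Rightarrow> real"
  assumes h_nonneg: "\<And>x. 0 \<le> x \<Longrightarrow> 0 \<le> h x"
    and h_mono: "mono_on {0..} h"
    and h_le: "\<And>x. 0 \<le> x \<Longrightarrow> h x \<le> sqrt x"
    and h_sqrt: "h \<notin> \<Omega>(sqrt)"
    and \<tau>_pos: "\<And>x. 0 \<le> x \<Longrightarrow> 0 < \<tau> x"
    and \<tau>_antimono: "antimono_on {0..} \<tau>"
    and \<mu>_pos: "0 < \<mu> 1"
    and \<mu>_mono: "mono_on {1..} \<mu>"
    and \<mu>_lim: "filterlim \<mu> at_top sequentially"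
    and \<tau>_summable: "summable (\<lambda>i. \<tau> (\<mu> (Suc i)))"
    and h_\<mu>_pos: "\<And>i. 1 \<le> i \<Longrightarrow> 0 < h (\<mu> i)"
  shows "\<exists>D f a\<^sub>1 \<xi> (\<psi> :: nat \<Rightarrow> nat \<Rightarrow> nat \<Rightarrow> real \<times> real \<Rightarrow> real).
    D = horn_domain f \<and> open D \<and> connected D \<and>
    (\<forall>x>0. 0 < f x) \<and>
    (\<forall>x>0. continuous (at_right x) f) \<and>
    a\<^sub>1 > 0 \<and> antimono_on {a\<^sub>1..} f \<and> (f \<longlongrightarrow> 0) at_top \<and>
    set_integrable lborel {0<..} f \<and>
    set_integrable lborel {a\<^sub>1..} (\<lambda>x. f x * h (pi\<^sup>2 / (f x)\<^sup>2)) \<and>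
    (\<exists>c>0. \<exists>C>0. \<forall>i\<ge>1. c * ((h (\<mu> i))\<^sup>2 / (\<mu> i * (\<tau> (\<mu> i))\<^sup>2)) \<le> \<xi> i \<and>
                        \<xi> i \<le> C * ((h (\<mu> i))\<^sup>2 / (\<mu> i * (\<tau> (\<mu> i))\<^sup>2))) \<and>
    (\<exists>C>0. \<forall>i\<ge>1. \<forall>m\<ge>1. \<forall>n\<ge>1.
        quasimode D (\<psi> i m n) ((real n)\<^sup>2 * \<mu> i + (real m)\<^sup>2 * \<xi> i) (C * (real m * \<xi> i))) \<and>
    (\<forall>i\<ge>1. \<forall>m\<ge>1. \<forall>n\<ge>1. \<forall>i'\<ge>1. \<forall>m'\<ge>1. \<forall>n'\<ge>1.
        i \<noteq> i' \<or> n \<noteq> n' \<longrightarrow> L2_inner D (\<psi> i m n) (\<psi> i' m' n') = 0) \<and>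
    (\<exists>C>0. \<forall>i\<ge>1. \<forall>m\<ge>1. \<forall>m'\<ge>1. \<forall>n\<ge>1. m \<noteq> m' \<longrightarrow>
        \<bar>L2_inner D (\<psi> i m n) (\<psi> i m' n)\<bar>
          \<le> C * (min 0.001 (1 / \<bar>real m - real m'\<bar>)
                 * L2_norm D (\<psi> i m n) * L2_norm D (\<psi> i m' n))) \<and>
    (\<forall>K. compact K \<and> K \<subseteq> D \<longrightarrow>
        uniform_limit ({1..} \<times> {1..})
          (\<lambda>i (m, n). L2_norm (D - K) (\<psi> i m n) / L2_norm D (\<psi> i m n)) (\<lambda>_. 1) sequentially)"
proof -
  \<comment> \<open>The given sequence starts at index 1 and \<open>\<mu> 0\<close> is
    unconstrained, so it is shifted to start at 0.\<close>
  define M where "M i = \<mu> (Suc i)" for i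
  have M_mono: "mono M"
    using \<mu>_mono by (auto simp: M_def mono_def mono_on_def)
  have M_lim: "filterlim M at_top sequentially"
    unfolding M_def using \<mu>_lim by (simp add: filterlim_sequentially_Suc)
  have M_0: "0 < M 0" using \<mu>_pos by (simp add: M_def)
  have M_pos: "0 < M i" for i using M_0 monoD[OF M_mono, of 0 i] by simp
  have h_M: "0 < h (M i)" and h_M_0: "h (M 0) \<le> h (M i)" for i
    using h_\<mu>_pos M_pos[of 0] M_pos[of i] monoD[OF M_mono, of 0 i] mono_onD[OF h_mono, of "M 0" "M i"]
    by (auto simp: M_def)
  have \<tau>_M: "0 < \<tau> (M i)" for i using \<tau>_pos M_pos[of i] by simp
  have \<tau>_sum: "summable (\<lambda>i. \<tau> (M i))" using \<tau>_summable by (simp add: M_def)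
  obtain \<nu> \<kappa> where \<nu>: "\<And>i. M i \<le> \<nu> i" "\<And>i. \<nu> i \<le> M (Suc i)" and \<kappa>: "\<And>i. 0 \<le> \<kappa> i" "\<not> summable \<kappa>"
    "summable (\<lambda>i. \<kappa> i * ((1 + h (\<nu> i)) / sqrt (\<nu> i)))"
    using filler_sequence[OF h_nonneg h_sqrt M_0 M_mono M_lim] by blast
  have \<nu>_pos: "0 < \<nu> i" for i using M_pos[of i] \<nu>(1)[of i] by simp
  have h_\<nu>: "0 \<le> h (\<nu> i)" for i using h_nonneg \<nu>_pos[of i] by simp
  \<comment> \<open>With this length, \<open>(pi / l i)\<^sup>2\<close> is exactly
    \<open>pi\<^sup>2\<close> times the prescribed size of the quasi-eigenvalue increment.\<close>
  define l where "l i = sqrt (M i) * \<tau> (M i) / h (M i)" for i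
  have l_pos: "0 < l i" for i using M_pos h_M \<tau>_M by (simp add: l_def)
  \<comment> \<open>Even steps carry the modes, odd steps are the fillers.\<close>
  define v where "v j = (if even j then M (j div 2) else \<nu> (j div 2))" for j
  define L where "L j = (if even j then l (j div 2) else \<kappa> (j div 2))" for j

  interpret staircase v L
  proof
    show "0 < v j" for j by (simp add: v_def M_pos \<nu>_pos)
    show "mono v"
      unfolding mono_iff_le_Suc
    proof
      fix j show "v j \<le> v (Suc j)"
        using \<nu> by (cases "even j") (auto simp: v_def elim!: evenE oddE)
    qed
    have "filterlim (\<lambda>j::nat. j div 2) at_top sequentially"
      unfolding filterlim_at_top
    proof
      fix Z :: nat
      show "eventually (\<lambda>j. Z \<le> j div 2) sequentially"
        using eventually_ge_at_top[of "2 * Z"] by eventually_elim simp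
    qed
    then have "filterlim (\<lambda>j. M (j div 2)) at_top sequentially"
      by (rule filterlim_compose[OF M_lim])
    then show "filterlim v at_top sequentially"
      by (rule filterlim_at_top_mono) (auto simp: v_def \<nu>)
    show "0 \<le> L j" for j by (simp add: L_def \<kappa> less_imp_le[OF l_pos])
    show "0 < L 0" by (simp add: L_def l_pos)
    show "\<not> summable L"
    proof
      assume "summable L"
      then have "summable (L \<circ> (\<lambda>i. Suc (2 * i)))"
        by (rule summable_reindex) (auto simp: inj_on_def L_def \<kappa> less_imp_le[OF l_pos])
      with \<kappa>(2) show False by (simp add: L_def o_def)
    qed
  qed

  have \<tau>_pi: "summable (\<lambda>i. C * \<tau> (M i))" for C
    using \<tau>_sum by (rule summable_mult)
  have \<kappa>_pi: "summable (\<lambda>i. pi * (\<kappa> i * ((1 + h (\<nu> i)) / sqrt (\<nu> i))))"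
    using \<kappa>(3) by (rule summable_mult)
  have "summable (\<lambda>j. L j * height j)"
  proof (rule summable_even_odd)
    show "0 \<le> L j * height j" for j using L_nonneg height_pos[of j] by simp
    show "summable (\<lambda>i. L (2 * i) * height (2 * i))"
    proof (rule summable_comparison_test'[OF \<tau>_pi[of "pi / h (M 0)"]])
      fix i
      \<comment> \<open>The plain area of a mode strip lacks the weight that cancels
        \<open>h (M i)\<close>. As \<open>h\<close> is increasing, the denominator is bounded below
        by \<open>h (M 0)\<close>.\<close>
      have "L (2 * i) * height (2 * i) = pi * \<tau> (M i) / h (M i)"
        using M_pos[of i] by (simp add: L_def height_def v_def l_def)
      also have "\<dots> \<le> pi * \<tau> (M i) / h (M 0)"
        using h_M[of 0] h_M[of i] h_M_0[of i] \<tau>_M[of i] by (intro divide_left_mono) auto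
      finally show "norm (L (2 * i) * height (2 * i)) \<le> pi / h (M 0) * \<tau> (M i)"
        using L_nonneg height_pos[of "2 * i"] by simp
    qed
    show "summable (\<lambda>i. L (Suc (2 * i)) * height (Suc (2 * i)))"
    proof (rule summable_comparison_test'[OF \<kappa>_pi])
      fix i
      \<comment> \<open>The summand 1 in \<open>1 + h (\<nu> i)\<close> pays for the plain area of
        the fillers; the other summand pays for their weighted area.\<close>
      have "L (Suc (2 * i)) * height (Suc (2 * i)) = pi * (\<kappa> i * (1 / sqrt (\<nu> i)))"
        by (simp add: L_def height_def v_def)
      also have "\<dots> \<le> pi * (\<kappa> i * ((1 + h (\<nu> i)) / sqrt (\<nu> i)))"
        using \<kappa>(1)[of i] h_\<nu>[of i] \<nu>_pos[of i] by (intro mult_left_mono divide_right_mono) auto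
      finally show "norm (L (Suc (2 * i)) * height (Suc (2 * i))) \<le> pi * (\<kappa> i * ((1 + h (\<nu> i)) / sqrt (\<nu> i)))"
        using L_nonneg height_pos[of "Suc (2 * i)"] by simp
    qed
  qed
  from set_integrable_stairs[OF less_imp_le[OF height_pos] this]
  have area: "set_integrable lborel {0..} stairs" by (simp add: stairs_def[abs_def])

  have h_v: "0 \<le> h (v j)" for j using h_nonneg v_pos[of j] by simp
  have hh: "0 \<le> height j * h (v j)" for j using h_v height_pos[of j] by simp
  have "summable (\<lambda>j. L j * (height j * h (v j)))"
  proof (rule summable_even_odd)
    show "0 \<le> L j * (height j * h (v j))" for j using L_nonneg hh by simp
    have "L (2 * i) * (height (2 * i) * h (v (2 * i))) = pi * \<tau> (M i)" for i
      using M_pos[of i] h_M[of i] by (simp add: L_def height_def v_def l_def)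
    then show "summable (\<lambda>i. L (2 * i) * (height (2 * i) * h (v (2 * i))))"
      using \<tau>_pi[of pi] by simp
    show "summable (\<lambda>i. L (Suc (2 * i)) * (height (Suc (2 * i)) * h (v (Suc (2 * i)))))"
    proof (rule summable_comparison_test'[OF \<kappa>_pi])
      fix i
      have "L (Suc (2 * i)) * (height (Suc (2 * i)) * h (v (Suc (2 * i)))) = pi * (\<kappa> i * (h (\<nu> i) / sqrt (\<nu> i)))"
        by (simp add: L_def height_def v_def)
      also have "\<dots> \<le> pi * (\<kappa> i * ((1 + h (\<nu> i)) / sqrt (\<nu> i)))"
        using \<kappa>(1)[of i] h_\<nu>[of i] \<nu>_pos[of i] by (intro mult_left_mono divide_right_mono) auto
      finally show "norm (L (Suc (2 * i)) * (height (Suc (2 * i)) * h (v (Suc (2 * i)))))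
          \<le> pi * (\<kappa> i * ((1 + h (\<nu> i)) / sqrt (\<nu> i)))"
        using L_nonneg hh[of "Suc (2 * i)"] by simp
    qed
  qed
  from set_integrable_stairs[OF hh this]
  have h_area: "set_integrable lborel {0..} (\<lambda>x. stairs x * h (pi\<^sup>2 / (stairs x)\<^sup>2))"
    by (simp add: stairs_def pi_over_height)

  \<comment> \<open>The i-th mode strip, counted from 1, is an even step. Truncated subtraction
    sends 0 and 1 to the same step, so injectivity holds from 1 on.\<close>
  define j where "j i = 2 * (i - 1)" for i :: nat
  define \<xi> where "\<xi> i = (pi / L (j i))\<^sup>2" for i
  define \<psi> where "\<psi> i = stair_mode (j i)" for i
  have j_L: "L (j i) > 0" for i by (simp add: j_def L_def l_pos)
  have j_v: "v (j i) = \<mu> i" if "i \<ge> 1" for i using that by (simp add: j_def v_def M_def)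
  have j_inj: "j i \<noteq> j i'" if "i \<ge> 1" "i' \<ge> 1" "i \<noteq> i'" for i i' using that by (simp add: j_def)
  have \<xi>_eq: "\<xi> i = pi\<^sup>2 * ((h (\<mu> i))\<^sup>2 / (\<mu> i * (\<tau> (\<mu> i))\<^sup>2))" if "i \<ge> 1" for i
    using that M_pos[of "i - 1"] by (simp add: \<xi>_def j_def L_def l_def M_def power_divide power_mult_distrib)
  note box = strip_subset[of "j i" for i]
  have norm_pos: "L2_norm horn (\<psi> i m n) > 0" if "m \<ge> 1" "n \<ge> 1" for i m n
    unfolding \<psi>_def stair_mode_def by (rule L2_norm_strip_mode(1)[OF box j_L height_pos that])

  show ?thesis
  \<comment> \<open>The value 1 for \<open>a\<^sub>1\<close> is arbitrary among positive numbers: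
    \<open>stairs\<close> decreases everywhere and both integrals are finite from 0 on.\<close>
  proof (rule exI[of _ horn], rule exI[of _ stairs], rule exI[of _ 1], rule exI[of _ \<xi>], rule exI[of _ \<psi>],
      intro conjI)
    show "horn = horn_domain stairs" ..
    show "open horn" "connected horn" by (rule open_horn connected_horn)+
    show "\<forall>x>0. 0 < stairs x" by (simp add: stairs_pos)
    show "\<forall>x>0. continuous (at_right x) stairs" by (simp add: stairs_right_continuous)
    show "(1::real) > 0" by simp
    show "antimono_on {1..} stairs" by (auto intro!: monotone_onI stairs_antimono)
    show "(stairs \<longlongrightarrow> 0) at_top" by (rule stairs_tendsto_0)
    show "set_integrable lborel {0<..} stairs"
      by (rule set_integrable_subset[OF area]) auto
    show "set_integrable lborel {1..} (\<lambda>x. stairs x * h (pi\<^sup>2 / (stairs x)\<^sup>2))"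
      by (rule set_integrable_subset[OF h_area]) auto
    show "\<exists>c>0. \<exists>C>0. \<forall>i\<ge>1. c * ((h (\<mu> i))\<^sup>2 / (\<mu> i * (\<tau> (\<mu> i))\<^sup>2)) \<le> \<xi> i \<and>
        \<xi> i \<le> C * ((h (\<mu> i))\<^sup>2 / (\<mu> i * (\<tau> (\<mu> i))\<^sup>2))"
      by (intro exI[of _ "pi\<^sup>2"] conjI) (auto simp: \<xi>_eq)
    show "\<exists>C>0. \<forall>i\<ge>1. \<forall>m\<ge>1. \<forall>n\<ge>1.
        quasimode horn (\<psi> i m n) ((real n)\<^sup>2 * \<mu> i + (real m)\<^sup>2 * \<xi> i) (C * (real m * \<xi> i))"
    proof (intro exI[of _ 6] conjI allI impI)
      fix i m n :: nat assume *: "i \<ge> 1" "m \<ge> 1" "n \<ge> 1"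
      show "quasimode horn (\<psi> i m n) ((real n)\<^sup>2 * \<mu> i + (real m)\<^sup>2 * \<xi> i) (6 * (real m * \<xi> i))"
        using strip_mode_quasimode[OF open_horn box[of i] j_L height_pos *(2,3) strip_boundary[of _ "j i"]]
        by (simp add: \<psi>_def stair_mode_def \<xi>_def pi_over_height j_v[OF *(1)])
    qed simp
    show "\<forall>i\<ge>1. \<forall>m\<ge>1. \<forall>n\<ge>1. \<forall>i'\<ge>1. \<forall>m'\<ge>1. \<forall>n'\<ge>1.
        i \<noteq> i' \<or> n \<noteq> n' \<longrightarrow> L2_inner horn (\<psi> i m n) (\<psi> i' m' n') = 0"
    proof (intro allI impI)
      fix i m n i' m' n' :: nat
      assume *: "i \<ge> 1" "m \<ge> 1" "n \<ge> 1" "i' \<ge> 1" "m' \<ge> 1" "n' \<ge> 1" "i \<noteq> i' \<or> n \<noteq> n'"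
      show "L2_inner horn (\<psi> i m n) (\<psi> i' m' n') = 0"
      proof (cases "i = i'")
        case True
        with * show ?thesis
          using L2_inner_strip_mode[OF box[of i] j_L height_pos, of m m' n n']
          by (simp add: \<psi>_def stair_mode_def)
      next
        case False
        with * show ?thesis unfolding \<psi>_def by (intro L2_inner_stair_mode_eq_0 j_inj)
      qed
    qed
    show "\<exists>C>0. \<forall>i\<ge>1. \<forall>m\<ge>1. \<forall>m'\<ge>1. \<forall>n\<ge>1. m \<noteq> m' \<longrightarrow>
        \<bar>L2_inner horn (\<psi> i m n) (\<psi> i m' n)\<bar>
          \<le> C * (min 0.001 (1 / \<bar>real m - real m'\<bar>)
                 * L2_norm horn (\<psi> i m n) * L2_norm horn (\<psi> i m' n))"
    proof (intro exI[of _ 1000] conjI allI impI)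
      fix i m m' n :: nat assume *: "m \<ge> 1" "m' \<ge> 1" "n \<ge> 1" "m \<noteq> m'"
      show "\<bar>L2_inner horn (\<psi> i m n) (\<psi> i m' n)\<bar>
          \<le> 1000 * (min 0.001 (1 / \<bar>real m - real m'\<bar>)
                 * L2_norm horn (\<psi> i m n) * L2_norm horn (\<psi> i m' n))"
        unfolding \<psi>_def stair_mode_def
        by (rule strip_mode_quasi_orthogonal[OF box[of i] j_L height_pos *])
    qed simp
    show "\<forall>K. compact K \<and> K \<subseteq> horn \<longrightarrow> uniform_limit ({1..} \<times> {1..})
        (\<lambda>i (m, n). L2_norm (horn - K) (\<psi> i m n) / L2_norm horn (\<psi> i m n)) (\<lambda>_. 1) sequentially"
    proof (intro allI impI)
      fix K :: "(real \<times> real) set" assume "compact K \<and> K \<subseteq> horn"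
      then have "compact K" ..
      from L2_norm_stair_mode_escapes[OF this] obtain J where
        J: "\<forall>i\<ge>J. \<forall>m n. L2_norm (horn - K) (stair_mode i m n) = L2_norm horn (stair_mode i m n)" ..
      \<comment> \<open>Beyond the threshold the ratio is exactly 1. \<open>Suc J\<close> accounts
        for \<open>j i\<close> being twice \<open>i - 1\<close>.\<close>
      have one: "L2_norm (horn - K) (\<psi> i m n) / L2_norm horn (\<psi> i m n) = 1"
        if "i \<ge> Suc J" "m \<ge> 1" "n \<ge> 1" for i m n
      proof -
        have "J \<le> j i" using that(1) by (simp add: j_def)
        with J have "L2_norm (horn - K) (\<psi> i m n) = L2_norm horn (\<psi> i m n)"
          by (simp only: \<psi>_def)
        with norm_pos[OF that(2,3), of i] show ?thesis by simp
      qed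
      show "uniform_limit ({1..} \<times> {1..})
          (\<lambda>i (m, n). L2_norm (horn - K) (\<psi> i m n) / L2_norm horn (\<psi> i m n)) (\<lambda>_. 1) sequentially"
        unfolding uniform_limit_iff
      proof (intro allI impI eventually_sequentiallyI[of "Suc J"] ballI)
        fix e :: real and i :: nat and p :: "nat \<times> nat"
        assume "e > 0" "Suc J \<le> i" "p \<in> {1..} \<times> {1..}"
        moreover obtain m n where p: "p = (m, n)" by (cases p)
        ultimately have "i \<ge> Suc J" "m \<ge> 1" "n \<ge> 1" by auto
        from one[OF this] \<open>e > 0\<close>
        show "dist (case p of (m, n) \<Rightarrow> L2_norm (horn - K) (\<psi> i m n) / L2_norm horn (\<psi> i m n)) 1 < e"
          unfolding p prod.case by (simp only: dist_self)
      qed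
    qed
  qed
qed

end
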